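(* Let $Y$ be an indecomposable rational function with complex coefficients, of degree at least two, that has a zero of order at least two at $0$, and let $n\ge 2$ be an integer. Then the conditions $$\mathbb{C}(z^n,Y)=\mathbb{C}(z)\quad\text{and}\quad \mathbb{C}(z^n)\cap\mathbb{C}(Y)\neq\mathbb{C}$$ both hold if and only if $Y=\sigma\circ z^sR(z^n)$, where $\sigma$ is a Möbius transformation, $R$ is a rational function, and $s\ge 0$ is an integer such that $\gcd(s,n)=1$.
   Context: A rational function is indecomposable if it cannot be represented as a composition of two rational functions of degree at least two. Here $\sigma\circ z^sR(z^n)$ denotes the rational function $z\mapsto\sigma(z^sR(z^n))$. *)

theory Defs
  imports
    "HOL-Computational_Algebra.Computational_Algebra"
    "HOL-Computational_Algebra.Field_as_Ring"
begin

text \<open>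
  Rational functions in one variable \<open>z\<close> over the complex numbers are the elements of the field
  \<open>\<complex>(z)\<close>, i.e. of the fraction field of the polynomial ring.
\<close>

type_synonym ratfun = "complex poly fract"

definition rat_const :: "complex \<Rightarrow> ratfun" where
  "rat_const c = to_fract [:c:]"

definition rat_var :: ratfun where
  "rat_var = to_fract [:0, 1:]"

text \<open>\<^const>\<open>quot_of_fract\<close> returns coprime numerator and denominator, the latter monic.\<close>

definition rat_num :: "ratfun \<Rightarrow> complex poly" where
  "rat_num f = fst (quot_of_fract f)"

definition rat_den :: "ratfun \<Rightarrow> complex poly" where
  "rat_den f = snd (quot_of_fract f)"

definition rat_degree :: "ratfun \<Rightarrow> nat" where
  "rat_degree f = max (degree (rat_num f)) (degree (rat_den f))"

text \<open>
  For \<open>f \<noteq> 0\<close> this is the order of \<open>f\<close> as a zero at \<open>a\<close>; it is \<open>0\<close> if \<open>f\<close> has no zero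
  at \<open>a\<close>, in particular at poles. It has no meaning for \<open>f = 0\<close>.
\<close>

definition rat_zero_order :: "complex \<Rightarrow> ratfun \<Rightarrow> nat" where
  "rat_zero_order a f = order a (rat_num f)"

text \<open>
  Composition \<open>f \<circ> g\<close>: substitute \<open>g\<close> for the variable in numerator and denominator of \<open>f\<close>.
  The denominator vanishes after substitution only if \<open>g\<close> is constant and equal to a pole of
  \<open>f\<close>; the composition is then the constant \<open>\<infinity>\<close>, which is not an element of \<open>\<complex>(z)\<close>, and the
  definition returns the constant \<open>0\<close>.
\<close>

definition rat_compose :: "ratfun \<Rightarrow> ratfun \<Rightarrow> ratfun" where
  "rat_compose f g =
     poly (map_poly rat_const (rat_num f)) g / poly (map_poly rat_const (rat_den f)) g"

definition rat_indecomposable :: "ratfun \<Rightarrow> bool" where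
  "rat_indecomposable f \<longleftrightarrow>
     \<not> (\<exists>g h. rat_degree g \<ge> 2 \<and> rat_degree h \<ge> 2 \<and> f = rat_compose g h)"

definition moebius :: "ratfun \<Rightarrow> bool" where
  "moebius \<sigma> \<longleftrightarrow>
     (\<exists>a b c d. a * d - b * c \<noteq> 0 \<and>
        \<sigma> = (rat_const a * rat_var + rat_const b) / (rat_const c * rat_var + rat_const d))"

definition is_subfield :: "'a::field set \<Rightarrow> bool" where
  "is_subfield K \<longleftrightarrow>
     0 \<in> K \<and> 1 \<in> K \<and>
     (\<forall>x\<in>K. \<forall>y\<in>K. x - y \<in> K) \<and> (\<forall>x\<in>K. \<forall>y\<in>K. x * y \<in> K) \<and> (\<forall>x\<in>K. inverse x \<in> K)"

text \<open>\<open>\<complex>(S)\<close>, the smallest subfield of \<open>\<complex>(z)\<close> containing the constants and \<open>S\<close>.\<close>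

definition rat_adjoin :: "ratfun set \<Rightarrow> ratfun set" where
  "rat_adjoin S = is_subfield hull (range rat_const \<union> S)"

end

theory Submission
  imports Defs
begin

text \<open>
  Let \<open>\<epsilon>\<close> be a primitive \<open>n\<close>-th root of unity and \<open>Y\<^sub>\<epsilon>(z) = Y(\<epsilon>z)\<close>. A nonconstant element
  \<open>A(z\<^sup>n) = B(Y)\<close> of the intersection is invariant under \<open>z \<mapsto> \<epsilon>z\<close>, so \<open>B(Y\<^sub>\<epsilon>) = B(Y)\<close>.
  Near \<open>0\<close> the map \<open>B\<close> is a power of a local coordinate, which makes \<open>Y\<^sub>\<epsilon>\<close> a power series in \<open>Y\<close>.
  The rational functions that are Laurent series in \<open>Y\<close> form a field between \<open>\<complex>(Y)\<close> and \<open>\<complex>(z)\<close>;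
  it misses \<open>z\<close>, because \<open>Y\<close> has a multiple zero at \<open>0\<close>, so by Lueroth's theorem and
  indecomposability it is \<open>\<complex>(Y)\<close>. Hence \<open>Y\<^sub>\<epsilon> = \<mu> \<circ> Y\<close> with \<open>\<mu>\<close> of degree one fixing \<open>0\<close>, and
  \<open>1/Y\<close> minus a suitable constant is an eigenvector \<open>W\<close> of \<open>z \<mapsto> \<epsilon>z\<close>, i.e. \<open>W = z\<^sup>s R(z\<^sup>n)\<close>.
  If \<open>gcd(s,n) > 1\<close>, a nontrivial power of the rotation would fix \<open>z\<^sup>n\<close> and \<open>Y\<close>, hence all of
  \<open>\<complex>(z)\<close>. The converse is Bezout's identity applied to the exponents \<open>s\<close> and \<open>n\<close>.
\<close>

section \<open>Composition of rational functions\<close>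

lemma rat_const_0 [simp]: "rat_const 0 = 0"
  and rat_const_1 [simp]: "rat_const 1 = 1"
  by (simp_all add: rat_const_def flip: one_pCons)

lemma rat_const_add [simp]: "rat_const (a + b) = rat_const a + rat_const b"
  and rat_const_diff [simp]: "rat_const (a - b) = rat_const a - rat_const b"
  and rat_const_minus [simp]: "rat_const (- a) = - rat_const a"
  by (simp_all add: rat_const_def flip: to_fract_add to_fract_diff to_fract_uminus)

lemma rat_const_mult [simp]: "rat_const (a * b) = rat_const a * rat_const b"
  by (simp add: rat_const_def flip: to_fract_mult)

lemma rat_const_eq_iff [simp]: "rat_const a = rat_const b \<longleftrightarrow> a = b"
  by (simp add: rat_const_def)

lemma rat_const_eq_0_iff [simp]: "rat_const a = 0 \<longleftrightarrow> a = 0"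
  using rat_const_eq_iff[of a 0] by simp

lemma rat_const_inverse [simp]: "rat_const (inverse a) = inverse (rat_const a)"
proof (cases "a = 0")
  case False
  have "rat_const a * rat_const (inverse a) = 1"
    using False by (simp flip: rat_const_mult)
  then show ?thesis by (metis inverse_unique)
qed simp

lemma rat_const_divide [simp]: "rat_const (a / b) = rat_const a / rat_const b"
  by (simp add: divide_inverse)

lemma rat_const_power [simp]: "rat_const (a ^ k) = rat_const a ^ k"
  by (induction k) auto

text \<open>Isolates the numerator and the denominator of \<open>rat_compose\<close>; for fixed
  \<open>h\<close> it is a ring homomorphism in the polynomial.\<close>

definition rat_eval :: "complex poly \<Rightarrow> ratfun \<Rightarrow> ratfun" where
  "rat_eval p h = poly (map_poly rat_const p) h"

lemma rat_eval_0 [simp]: "rat_eval 0 h = 0"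
  by (simp add: rat_eval_def)

lemma rat_eval_pCons [simp]: "rat_eval (pCons a p) h = rat_const a + h * rat_eval p h"
  by (simp add: rat_eval_def map_poly_pCons)

lemma rat_eval_1 [simp]: "rat_eval 1 h = 1"
  by (simp add: one_pCons)

lemma rat_eval_add [simp]: "rat_eval (p + q) h = rat_eval p h + rat_eval q h"
  by (induction p q rule: poly_induct2) (auto simp: algebra_simps)

lemma rat_eval_minus [simp]: "rat_eval (- p) h = - rat_eval p h"
  by (induction p) (auto simp: algebra_simps)

lemma rat_eval_diff [simp]: "rat_eval (p - q) h = rat_eval p h - rat_eval q h"
  using rat_eval_add[of p "- q" h] by simp

lemma rat_eval_smult [simp]: "rat_eval (smult c p) h = rat_const c * rat_eval p h"
  by (induction p) (auto simp: algebra_simps)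

lemma rat_eval_mult [simp]: "rat_eval (p * q) h = rat_eval p h * rat_eval q h"
  by (induction p) (auto simp: algebra_simps)

lemma rat_eval_pcompose: "rat_eval (pcompose p q) h = rat_eval p (rat_eval q h)"
  by (induction p) (auto simp: pcompose_pCons algebra_simps)

lemma to_fract_pCons: "to_fract (pCons a p) = rat_const a + rat_var * to_fract p"
proof -
  have "pCons a p = [:a:] + [:0, 1:] * p" by simp
  then show ?thesis
    unfolding rat_const_def rat_var_def by (metis to_fract_add to_fract_mult)
qed

lemma rat_eval_var [simp]: "rat_eval p rat_var = to_fract p"
  by (induction p) (auto simp: to_fract_pCons)

lemma rat_eval_const [simp]: "rat_eval p (rat_const c) = rat_const (poly p c)"
  by (induction p) auto

section \<open>Fractions and their reduced form\<close>

lemma rat_den_nonzero [simp]: "rat_den f \<noteq> 0"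
  by (simp add: rat_den_def)

lemma rat_num_eq_0_iff [simp]: "rat_num f = 0 \<longleftrightarrow> f = 0"
  by (simp add: rat_num_def)

lemma coprime_rat_num_den: "coprime (rat_num f) (rat_den f)"
  by (simp add: rat_num_def rat_den_def coprime_quot_of_fract)

lemma rat_num_div_den: "f = to_fract (rat_num f) / to_fract (rat_den f)"
  by (metis Fract_conv_to_fract Fract_quot_of_fract rat_num_def rat_den_def)

text \<open>Compares an arbitrary representation with the reduced one by a polynomial identity, so
  the cancelled factor never has to be named.\<close>

lemma rat_num_den_cross:
  fixes p q :: "complex poly"
  assumes "q \<noteq> 0"
  defines "f \<equiv> to_fract p / to_fract q"
  shows "p * rat_den f = rat_num f * q"
proof -
  have "to_fract p / to_fract q = to_fract (rat_num f) / to_fract (rat_den f)"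
    using rat_num_div_den[of f] by (simp add: f_def)
  then have "to_fract (p * rat_den f) = to_fract (rat_num f * q)"
    using assms(1) by (simp add: frac_eq_eq)
  then show ?thesis by (simp only: to_fract_eq_iff)
qed

lemma rat_num_den_no_common_root:
  assumes "poly (rat_num f) a = 0"
  shows "poly (rat_den f) a \<noteq> 0"
proof
  assume "poly (rat_den f) a = 0"
  with assms have "[:- a, 1:] dvd rat_num f" "[:- a, 1:] dvd rat_den f"
    by (simp_all add: poly_eq_0_iff_dvd)
  with coprime_rat_num_den[of f] have "is_unit [:- a, 1:]" by (rule coprime_common_divisor)
  then show False by (simp add: is_unit_iff_degree)
qed

section \<open>Composition with a nonconstant function as a field homomorphism\<close>

lemma rat_compose_eq: "rat_compose f h = rat_eval (rat_num f) h / rat_eval (rat_den f) h"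
  by (simp add: rat_compose_def rat_eval_def)

text \<open>Every polynomial over \<open>\<complex>\<close> splits, so vanishing at \<open>h\<close> forces \<open>h\<close> to be one of its roots.\<close>

lemma rat_eval_nonzero:
  assumes "h \<notin> range rat_const" "p \<noteq> 0"
  shows "rat_eval p h \<noteq> 0"
  using assms(2)
proof (induction "degree p" arbitrary: p)
  case 0
  then obtain c where "p = [:c:]" by (metis degree_eq_zeroE)
  with 0 show ?case by simp
next
  case (Suc n)
  then have "\<not> constant (poly p)" by (simp add: constant_degree)
  then obtain a where "poly p a = 0" using fundamental_theorem_of_algebra by blast
  then obtain q where q: "p = [:-a, 1:] * q" by (metis dvdE poly_eq_0_iff_dvd)
  with Suc.prems have "q \<noteq> 0" by auto
  then have "degree p = Suc (degree q)" unfolding q by (subst degree_mult_eq) auto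
  with Suc \<open>q \<noteq> 0\<close> have "rat_eval q h \<noteq> 0" by simp
  moreover have "h - rat_const a \<noteq> 0" using assms(1) by auto
  ultimately show ?case unfolding q rat_eval_mult by simp
qed

lemma rat_eval_eq_0_iff [simp]:
  "h \<notin> range rat_const \<Longrightarrow> rat_eval p h = 0 \<longleftrightarrow> p = 0"
  using rat_eval_nonzero by auto

text \<open>Composition may be computed from any representation, reduced or not; this is what makes
  it compatible with the field operations.\<close>

lemma rat_compose_fraction:
  assumes "h \<notin> range rat_const" "q \<noteq> 0"
  shows "rat_compose (to_fract p / to_fract q) h = rat_eval p h / rat_eval q h"
proof -
  define f where "f = to_fract p / to_fract q"
  have "p * rat_den f = rat_num f * q" unfolding f_def by (rule rat_num_den_cross[OF assms(2)])
  then have "rat_eval p h * rat_eval (rat_den f) h = rat_eval (rat_num f) h * rat_eval q h"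
    by (metis rat_eval_mult)
  then show ?thesis using assms unfolding rat_compose_eq f_def[symmetric]
    by (simp add: frac_eq_eq)
qed

lemma ratfun_cases:
  fixes f :: ratfun
  obtains p q where "q \<noteq> 0" "f = to_fract p / to_fract q"
  using rat_num_div_den[of f] rat_den_nonzero by blast

lemma rat_compose_to_fract [simp]:
  assumes "h \<notin> range rat_const"
  shows "rat_compose (to_fract p) h = rat_eval p h"
  using rat_compose_fraction[OF assms, of 1 p] by simp

lemma rat_compose_const [simp]:
  assumes "h \<notin> range rat_const"
  shows "rat_compose (rat_const c) h = rat_const c"
  using rat_compose_to_fract[OF assms, of "[:c:]"] by (simp add: rat_const_def)

lemma rat_compose_1 [simp]:
  assumes "h \<notin> range rat_const"
  shows "rat_compose 1 h = 1"
  using rat_compose_const[OF assms, of 1] by simp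

lemma rat_compose_0 [simp]:
  assumes "h \<notin> range rat_const"
  shows "rat_compose 0 h = 0"
  using rat_compose_const[OF assms, of 0] by simp

lemma rat_compose_var [simp]:
  assumes "h \<notin> range rat_const"
  shows "rat_compose rat_var h = h"
  using rat_compose_to_fract[OF assms, of "[:0, 1:]"] by (simp add: rat_var_def)

lemma rat_compose_var_right [simp]: "rat_compose f rat_var = f"
  using rat_num_div_den[of f] by (simp add: rat_compose_eq)

lemma rat_compose_mult [simp]:
  assumes "h \<notin> range rat_const"
  shows "rat_compose (f * g) h = rat_compose f h * rat_compose g h"
proof -
  obtain p q where f: "q \<noteq> 0" "f = to_fract p / to_fract q" by (rule ratfun_cases)
  obtain r s where g: "s \<noteq> 0" "g = to_fract r / to_fract s" by (rule ratfun_cases)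
  have "f * g = to_fract (p * r) / to_fract (q * s)" using f g by simp
  then show ?thesis unfolding f(2) g(2) using f g
    by (simp add: rat_compose_fraction[OF assms] del: to_fract_mult)
qed

lemma rat_compose_add [simp]:
  assumes "h \<notin> range rat_const"
  shows "rat_compose (f + g) h = rat_compose f h + rat_compose g h"
proof -
  obtain p q where f: "q \<noteq> 0" "f = to_fract p / to_fract q" by (rule ratfun_cases)
  obtain r s where g: "s \<noteq> 0" "g = to_fract r / to_fract s" by (rule ratfun_cases)
  have "f + g = to_fract (p * s + r * q) / to_fract (q * s)"
    using f g by (simp add: add_frac_eq)
  then show ?thesis unfolding f(2) g(2) using f g assms
    by (simp add: rat_compose_fraction[OF assms] add_frac_eq del: to_fract_mult to_fract_add)
qed

lemma rat_compose_minus [simp]: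
  assumes "h \<notin> range rat_const"
  shows "rat_compose (- f) h = - rat_compose f h"
  using rat_compose_add[OF assms, of f "- f"] assms by (simp add: eq_neg_iff_add_eq_0 add.commute)

lemma rat_compose_diff [simp]:
  assumes "h \<notin> range rat_const"
  shows "rat_compose (f - g) h = rat_compose f h - rat_compose g h"
  using rat_compose_add[OF assms, of f "- g"] assms by simp

lemma rat_compose_inverse [simp]:
  assumes "h \<notin> range rat_const"
  shows "rat_compose (inverse f) h = inverse (rat_compose f h)"
proof (cases "f = 0")
  case False
  then have "rat_compose f h * rat_compose (inverse f) h = 1"
    using assms by (simp flip: rat_compose_mult)
  then show ?thesis by (metis inverse_unique)
qed (use assms in simp)

lemma rat_compose_divide [simp]:
  assumes "h \<notin> range rat_const"
  shows "rat_compose (f / g) h = rat_compose f h / rat_compose g h"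
  using assms by (simp add: divide_inverse)

lemma rat_compose_power [simp]:
  assumes "h \<notin> range rat_const"
  shows "rat_compose (f ^ k) h = rat_compose f h ^ k"
  by (induction k) (use assms in auto)

lemma rat_compose_eval:
  assumes "h \<notin> range rat_const"
  shows "rat_compose (rat_eval p g) h = rat_eval p (rat_compose g h)"
  by (induction p) (use assms in auto)

lemma rat_compose_assoc:
  assumes "h \<notin> range rat_const"
  shows "rat_compose (rat_compose f g) h = rat_compose f (rat_compose g h)"
  unfolding rat_compose_eq[of f] using assms by (simp add: rat_compose_eval)

text \<open>A nonzero \<open>f\<close> has an inverse, and composing that inverse with
  \<open>h\<close> inverts the composition of \<open>f\<close> with \<open>h\<close>.\<close>

lemma rat_compose_eq_0_iff [simp]:
  assumes "h \<notin> range rat_const"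
  shows "rat_compose f h = 0 \<longleftrightarrow> f = 0"
proof (cases "f = 0")
  case False
  then have "rat_compose f h * rat_compose (inverse f) h = 1"
    by (simp add: rat_compose_mult[OF assms, symmetric] assms
        del: rat_compose_mult rat_compose_inverse)
  then show ?thesis using False by auto
qed (use assms in simp)

lemma rat_compose_eq_iff [simp]:
  assumes "h \<notin> range rat_const"
  shows "rat_compose f h = rat_compose g h \<longleftrightarrow> f = g"
  using rat_compose_eq_0_iff[OF assms, of "f - g"] assms by simp

lemma rat_compose_nonconstant [simp]:
  assumes "h \<notin> range rat_const"
  shows "rat_compose f h \<in> range rat_const \<longleftrightarrow> f \<in> range rat_const"
  using assms by (auto simp: image_iff) (metis assms rat_compose_const rat_compose_eq_iff)

text \<open>By coprimality the reduced numerator and denominator divide \<open>p\<close> and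
  \<open>q\<close>: cancellation can only lower degrees.\<close>

lemma rat_degree_fraction_le:
  assumes "q \<noteq> 0"
  shows "rat_degree (to_fract p / to_fract q) \<le> max (degree p) (degree q)"
proof -
  define f where "f = to_fract p / to_fract q"
  have eq: "p * rat_den f = rat_num f * q" unfolding f_def by (rule rat_num_den_cross[OF assms])
  then have "rat_den f dvd rat_num f * q" by (metis dvd_triv_right)
  then have "rat_den f dvd q"
    using coprime_rat_num_den[of f] by (simp add: coprime_dvd_mult_right_iff coprime_commute)
  then have 1: "degree (rat_den f) \<le> degree q" using assms by (rule dvd_imp_degree_le)
  have "rat_num f dvd p * rat_den f" using eq by simp
  then have "rat_num f dvd p"
    using coprime_rat_num_den[of f] by (simp add: coprime_dvd_mult_left_iff)
  then have "p \<noteq> 0 \<Longrightarrow> degree (rat_num f) \<le> degree p" by (rule dvd_imp_degree_le)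
  \<comment> \<open>Divisibility bounds no degree when \<open>p = 0\<close>; the reduced numerator
    is then zero itself.\<close>
  moreover have "p = 0 \<Longrightarrow> degree (rat_num f) = 0"
    by (simp add: f_def rat_num_def)
  ultimately show ?thesis using 1 unfolding f_def[symmetric] rat_degree_def by fastforce
qed

lemma rat_degree_eq_0_iff: "rat_degree f = 0 \<longleftrightarrow> f \<in> range rat_const"
proof
  assume "rat_degree f = 0"
  then have "degree (rat_num f) = 0" "degree (rat_den f) = 0" by (auto simp: rat_degree_def)
  then obtain a b where "rat_num f = [:a:]" "rat_den f = [:b:]" by (metis degree_eq_zeroE)
  then have "f = rat_const a / rat_const b"
    using rat_num_div_den[of f] by (simp add: rat_const_def)
  then have "f = rat_const (a / b)" by simp
  then show "f \<in> range rat_const" by blast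
next
  assume "f \<in> range rat_const"
  then obtain c where "f = to_fract [:c:] / to_fract 1" by (auto simp: rat_const_def)
  then show "rat_degree f = 0" using rat_degree_fraction_le[of 1 "[:c:]"] by simp
qed

lemma rat_var_nonconstant [simp]: "rat_var \<notin> range rat_const"
  by (auto simp: rat_const_def rat_var_def)

lemma nonconstant_nonzero: "f \<notin> range rat_const \<Longrightarrow> f \<noteq> 0"
  by (metis rangeI rat_const_0)

lemma rat_var_nonzero [simp]: "rat_var \<noteq> 0"
  by (rule nonconstant_nonzero) simp

lemma rat_degree_le_1E:
  assumes "rat_degree f \<le> 1"
  obtains a b c d where "rat_num f = [:a, b:]" "rat_den f = [:c, d:]"
proof -
  have "p = [:coeff p 0, coeff p 1:]" if "degree p \<le> 1" for p :: "complex poly"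
    using that by (intro poly_eqI) (auto simp: coeff_pCons coeff_eq_0 split: nat.split)
  then show thesis using assms that unfolding rat_degree_def by (metis max.bounded_iff)
qed

section \<open>Subfields of the field of rational functions\<close>

context
  fixes K :: "'a::field set"
  assumes K: "is_subfield K"
begin

lemma subfield_0: "0 \<in> K"
  and subfield_1: "1 \<in> K"
  and subfield_diff: "x \<in> K \<Longrightarrow> y \<in> K \<Longrightarrow> x - y \<in> K"
  and subfield_mult: "x \<in> K \<Longrightarrow> y \<in> K \<Longrightarrow> x * y \<in> K"
  and subfield_inverse: "x \<in> K \<Longrightarrow> inverse x \<in> K"
  using K by (auto simp: is_subfield_def)

lemma subfield_minus: "x \<in> K \<Longrightarrow> - x \<in> K"
  using subfield_diff[OF subfield_0] by simp

lemma subfield_add: "x \<in> K \<Longrightarrow> y \<in> K \<Longrightarrow> x + y \<in> K"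
  using subfield_diff[of x "- y"] subfield_minus[of y] by simp

lemma subfield_divide: "x \<in> K \<Longrightarrow> y \<in> K \<Longrightarrow> x / y \<in> K"
  by (simp add: divide_inverse subfield_mult subfield_inverse)

lemma subfield_power: "x \<in> K \<Longrightarrow> x ^ k \<in> K"
  by (induction k) (auto intro: subfield_1 subfield_mult)

text \<open>Long division only ever divides by the leading coefficient of \<open>q\<close>, so the
  remainder stays over \<open>K\<close> although the polynomials are typed over the whole
  field.\<close>

lemma subfield_poly_mod:
  assumes "\<And>i. coeff p i \<in> K" "\<And>i. coeff q i \<in> K"
  shows "coeff (p mod q) i \<in> K"
  using assms(1)
proof (induction "degree p" arbitrary: p rule: less_induct)
  case less
  consider "q = 0" | "degree p < degree q" | "q \<noteq> 0" "degree q \<le> degree p" by linarith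
  then show ?case
  proof cases
    case 3
    define c where "c = lead_coeff p / lead_coeff q"
    \<comment> \<open>One step of long division: \<open>r\<close> loses the leading term of
      \<open>p\<close> but keeps its remainder modulo \<open>q\<close>.\<close>
    define r where "r = p - monom c (degree p - degree q) * q"
    have r_mod: "r mod q = p mod q" by (simp add: r_def poly_mod_diff_left)
    have "degree (monom c (degree p - degree q) * q) \<le> degree p"
      using degree_mult_le[of "monom c (degree p - degree q)" q]
        degree_monom_le[of c "degree p - degree q"] 3 by linarith
    then have "degree r \<le> degree p" unfolding r_def by (intro degree_diff_le) auto
    moreover have "coeff r (degree p) = 0"
      using 3 by (simp add: r_def coeff_monom_mult c_def)
    ultimately have "r = 0 \<or> degree r < degree p" by (rule eq_zero_or_degree_less)
    moreover have "coeff r j \<in> K" for j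
      unfolding r_def c_def coeff_diff coeff_monom_mult
      using less.prems assms(2) subfield_0
      by (auto intro!: subfield_diff subfield_mult subfield_divide)
    ultimately have "coeff (r mod q) i \<in> K" using less.hyps subfield_0 by force
    then show ?thesis by (simp add: r_mod)
  qed (use less.prems in \<open>auto simp: mod_poly_less\<close>)
qed

end

lemma is_subfield_rat_adjoin: "is_subfield (rat_adjoin S)"
  unfolding rat_adjoin_def by (rule hull_in) (auto simp: is_subfield_def)

lemma rat_const_in_adjoin [simp]: "rat_const c \<in> rat_adjoin S"
  unfolding rat_adjoin_def by (rule hull_inc) simp

lemma in_rat_adjoin: "x \<in> S \<Longrightarrow> x \<in> rat_adjoin S"
  unfolding rat_adjoin_def by (rule hull_inc) simp

lemma rat_adjoin_minimal:
  "is_subfield K \<Longrightarrow> range rat_const \<subseteq> K \<Longrightarrow> S \<subseteq> K \<Longrightarrow> rat_adjoin S \<subseteq> K"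
  unfolding rat_adjoin_def by (rule hull_minimal) auto

lemma rat_eval_in_subfield:
  assumes "is_subfield K" "range rat_const \<subseteq> K" "h \<in> K"
  shows "rat_eval p h \<in> K"
  by (induction p) (use assms in \<open>auto intro: subfield_add subfield_mult subfield_0\<close>)

lemma rat_compose_in_subfield:
  assumes "is_subfield K" "range rat_const \<subseteq> K" "h \<in> K"
  shows "rat_compose f h \<in> K"
  unfolding rat_compose_eq by (intro subfield_divide rat_eval_in_subfield assms)

text \<open>Composition with \<open>h\<close> is a field homomorphism, so its image is a subfield;
  it contains the constants and \<open>h\<close>, and lies in every subfield that does.\<close>

lemma rat_adjoin_singleton:
  assumes "h \<notin> range rat_const"
  shows "rat_adjoin {h} = range (\<lambda>f. rat_compose f h)" (is "_ = ?R")
proof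
  have "is_subfield ?R"
    unfolding is_subfield_def
  proof (intro conjI ballI)
    show "0 \<in> ?R" using rat_compose_0[OF assms] by (metis rangeI)
    show "1 \<in> ?R" using rat_compose_1[OF assms] by (metis rangeI)
    show "x - y \<in> ?R" if "x \<in> ?R" "y \<in> ?R" for x y
      using that by (auto simp flip: rat_compose_diff[OF assms])
    show "x * y \<in> ?R" if "x \<in> ?R" "y \<in> ?R" for x y
      using that by (auto simp flip: rat_compose_mult[OF assms])
    show "inverse x \<in> ?R" if "x \<in> ?R" for x
      using that by (auto simp flip: rat_compose_inverse[OF assms])
  qed
  moreover have "range rat_const \<subseteq> ?R"
    using rat_compose_const[OF assms] by (metis image_subsetI rangeI)
  moreover have "h \<in> ?R" using rat_compose_var[OF assms] by (metis rangeI)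
  ultimately show "rat_adjoin {h} \<subseteq> ?R"
    by (meson rat_adjoin_minimal empty_subsetI insert_subset)
  show "?R \<subseteq> rat_adjoin {h}"
  proof clarify
    show "rat_compose f h \<in> rat_adjoin {h}" for f
      by (intro rat_compose_in_subfield is_subfield_rat_adjoin) (auto intro: in_rat_adjoin)
  qed
qed

section \<open>Lueroth's theorem\<close>

lemma coeff_mult_at_bounds:
  fixes p q :: "'a::comm_semiring_0 poly"
  assumes "degree p \<le> m" "degree q \<le> n"
  shows "coeff (p * q) (m + n) = coeff p m * coeff q n"
proof -
  have "coeff p i * coeff q (m + n - i) = 0" if "i \<noteq> m" for i
  proof (cases "i < m")
    case True
    then show ?thesis using assms by (simp add: coeff_eq_0)
  next
    case False
    then show ?thesis using assms that by (simp add: coeff_eq_0)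
  qed
  then have "coeff (p * q) (m + n) = (\<Sum>i\<in>{m}. coeff p i * coeff q (m + n - i))"
    unfolding coeff_mult by (intro sum.mono_neutral_right) auto
  then show ?thesis by simp
qed

text \<open>Reading \<open>p\<close> as P(z, T) with outer variable T, this is the coefficient of
  z^k, a polynomial in T.\<close>

definition inner_coeff :: "nat \<Rightarrow> 'a::comm_semiring_0 poly poly \<Rightarrow> 'a poly" where
  "inner_coeff k p = map_poly (\<lambda>c. coeff c k) p"

lemma coeff_inner_coeff [simp]: "coeff (inner_coeff k p) i = coeff (coeff p i) k"
  by (simp add: inner_coeff_def coeff_map_poly)

text \<open>In the product of two coefficients only one term reaches z^(m + n) under the degree
  bounds; thus leading z-coefficients multiply.\<close>

lemma inner_coeff_mult:
  assumes "\<And>i. degree (coeff p i) \<le> m" "\<And>i. degree (coeff q i) \<le> n"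
  shows "inner_coeff (m + n) (p * q) = inner_coeff m p * inner_coeff n q"
  unfolding poly_eq_iff coeff_inner_coeff coeff_mult[of p q] coeff_mult[of "inner_coeff m p"]
  by (simp add: coeff_sum coeff_mult_at_bounds assms)

text \<open>The \<open>m\<close> found is the z-degree of \<open>p\<close>, the largest degree of a
  coefficient. Together with \<open>inner_coeff_mult\<close> this makes z-degrees add in
  products.\<close>

lemma obtain_inner_degree:
  fixes p :: "'a::comm_semiring_0 poly poly"
  assumes "p \<noteq> 0"
  obtains m where "\<And>i. degree (coeff p i) \<le> m" "inner_coeff m p \<noteq> 0"
proof -
  define m where "m = Max (degree ` (coeff p ` {..degree p}))"
  have le: "degree (coeff p i) \<le> m" for i
  proof (cases "i \<le> degree p")
    case True
    then show ?thesis unfolding m_def by (intro Max_ge) auto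
  qed (simp add: coeff_eq_0)
  have "inner_coeff m p \<noteq> 0"
  \<comment> \<open>A zero coefficient also has degree \<open>0\<close>, so for \<open>m = 0\<close>
    attaining the maximum does not show nonvanishing; the leading coefficient serves
    instead.\<close>
  proof (cases "m = 0")
    case True
    have "coeff (lead_coeff p) 0 \<noteq> 0"
      using le[of "degree p"] True assms by (metis leading_coeff_0_iff le_zero_eq)
    then show ?thesis using True by (metis coeff_0 coeff_inner_coeff)
  next
    case False
    have "m \<in> degree ` (coeff p ` {..degree p})" unfolding m_def by (intro Max_in) auto
    then obtain i where "degree (coeff p i) = m" by auto
    then have "coeff (coeff p i) m \<noteq> 0" using False by (metis degree_0 leading_coeff_0_iff)
    then show ?thesis by (metis coeff_0 coeff_inner_coeff)
  qed
  with le that show thesis by blast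
qed

text \<open>For g = a/b this is a(T) - g b(T): it has z as a root, and its coefficients lie in
  C(g).\<close>

definition graph_poly :: "ratfun \<Rightarrow> ratfun poly" where
  "graph_poly g = map_poly rat_const (rat_num g) - smult g (map_poly rat_const (rat_den g))"

lemma poly_graph_poly_var [simp]: "poly (graph_poly g) rat_var = 0"
proof -
  have "to_fract (rat_num g) = g * to_fract (rat_den g)"
    by (subst (2) rat_num_div_den[of g]) simp
  then show ?thesis by (simp add: graph_poly_def flip: rat_eval_def)
qed

lemma graph_poly_nonzero:
  assumes "g \<notin> range rat_const"
  shows "graph_poly g \<noteq> 0"
proof
  assume 0: "graph_poly g = 0"
  define i where "i = degree (rat_den g)"
  have "rat_const (coeff (rat_num g) i) - g * rat_const (coeff (rat_den g) i) = 0"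
    using arg_cong[OF 0, of "\<lambda>p. coeff p i"] by (simp add: graph_poly_def coeff_map_poly)
  moreover have "coeff (rat_den g) i \<noteq> 0" by (simp add: i_def)
  ultimately have "g = rat_const (coeff (rat_num g) i / coeff (rat_den g) i)"
    by (simp add: field_simps)
  with assms show False by blast
qed

lemma graph_poly_over:
  assumes "is_subfield K" "range rat_const \<subseteq> K" "g \<in> K"
  shows "coeff (graph_poly g) i \<in> K"
  using assms by (auto simp: graph_poly_def coeff_map_poly intro!: subfield_diff subfield_mult)

text \<open>Reducing a(T) - g b(T) modulo \<open>p\<close> gives A = g B with A and B over
  \<open>K\<close>. Here B is nonzero because b does not vanish at z, so g is a quotient of two
  coefficients in \<open>K\<close>.\<close>

lemma in_subfield_if_graph_poly_dvd:
  assumes K: "is_subfield K" "range rat_const \<subseteq> K" and "\<And>i. coeff p i \<in> K"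
    and "poly p rat_var = 0" "p dvd graph_poly g"
  shows "g \<in> K"
proof -
  define A where "A = map_poly rat_const (rat_num g) mod p"
  define B where "B = map_poly rat_const (rat_den g) mod p"
  have "A - smult g B = graph_poly g mod p"
    by (simp add: graph_poly_def A_def B_def mod_smult_left poly_mod_diff_left)
  also have "\<dots> = 0" using assms(5) by simp
  finally have "A - smult g B = 0" .
  then have A: "coeff A i = g * coeff B i" for i
    using arg_cong[of "A - smult g B" 0 "\<lambda>p. coeff p i"] by simp
  have "B \<noteq> 0"
  proof
    assume "B = 0"
    then have "p dvd map_poly rat_const (rat_den g)" by (simp add: B_def mod_eq_0_iff_dvd)
    then have "rat_eval (rat_den g) rat_var = 0"
      using assms(4) by (metis dvdE mult_zero_left poly_mult rat_eval_def)
    then show False by simp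
  qed
  define i where "i = degree B"
  have "coeff B i \<noteq> 0" using \<open>B \<noteq> 0\<close> by (simp add: i_def)
  then have "g = coeff A i / coeff B i" by (simp add: A)
  moreover have "coeff A i \<in> K" "coeff B i \<in> K" unfolding A_def B_def
    using K assms(3) by (auto intro!: subfield_poly_mod simp: coeff_map_poly)
  ultimately show ?thesis using subfield_divide[OF K(1)] by metis
qed

text \<open>The minimal polynomial of \<open>z\<close> over \<open>F\<close> has primitive part \<open>P(z, T)\<close>, whose \<open>z\<close>-degree is at
  least the degree of each coefficient \<open>w = a/b\<close> of the monic polynomial. As \<open>P\<close> divides
  \<open>b(z) a(T) - a(z) b(T)\<close>, comparing \<open>z\<close>-degrees leaves only a constant cofactor.\<close>

theorem lueroth:
  assumes F: "is_subfield F" "range rat_const \<subseteq> F" and "Y \<in> F" "Y \<notin> range rat_const"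
  obtains w where "w \<in> F" "w \<notin> range rat_const" "F \<subseteq> rat_adjoin {w}"
proof -
  \<comment> \<open>An element of least degree in \<open>V\<close> is, up to a scalar, the minimal
    polynomial of z over \<open>F\<close>; \<open>graph_poly Y\<close> shows that \<open>V\<close>
    is nonempty.\<close>
  define V where "V = {q. q \<noteq> 0 \<and> (\<forall>i. coeff q i \<in> F) \<and> poly q rat_var = 0}"
  have "graph_poly Y \<in> V"
    using assms graph_poly_nonzero graph_poly_over by (auto simp: V_def)
  then obtain p where p: "p \<in> V" and least: "\<And>q. q \<in> V \<Longrightarrow> degree p \<le> degree q"
    using ex_has_least_nat[of "\<lambda>q. q \<in> V" _ degree] by blast
  have p0: "p \<noteq> 0" and pF: "coeff p i \<in> F" and pz: "poly p rat_var = 0" for i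
    using p by (auto simp: V_def)
  have p_dvd: "p dvd q" if "\<And>i. coeff q i \<in> F" "poly q rat_var = 0" for q
  proof (rule ccontr)
    assume "\<not> p dvd q"
    then have "q mod p \<noteq> 0" by (simp add: mod_eq_0_iff_dvd)
    moreover have "poly (q mod p) rat_var = 0"
      using that(2) pz by (simp flip: minus_div_mult_eq_mod)
    moreover have "coeff (q mod p) i \<in> F" for i
      by (intro subfield_poly_mod F that pF)
    ultimately have "q mod p \<in> V" by (simp add: V_def)
    then have "degree p \<le> degree (q mod p)" by (rule least)
    moreover have "degree (q mod p) < degree p"
      using degree_mod_less'[OF p0 \<open>q mod p \<noteq> 0\<close>] .
    ultimately show False by simp
  qed

  \<comment> \<open>Otherwise the monic multiple of \<open>p\<close> would be a nonzero complex
    polynomial with root z, but z is transcendental.\<close>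
  have "\<exists>i. coeff p i / lead_coeff p \<notin> range rat_const"
  proof (rule ccontr)
    assume *: "\<not> ?thesis"
    define r where "r = map_poly (inv rat_const) (smult (inverse (lead_coeff p)) p)"
    have inj: "inj rat_const" by (rule injI) simp
    have "inv rat_const 0 = 0" using inv_f_f[OF inj, of 0] by simp
    then have "map_poly rat_const r = smult (inverse (lead_coeff p)) p"
      using * by (intro poly_eqI) (auto simp: r_def coeff_map_poly f_inv_into_f divide_inverse mult.commute)
    then have "rat_eval r rat_var = 0" using pz by (simp add: rat_eval_def)
    then have "r = 0" by simp
    with \<open>map_poly rat_const r = _\<close> p0 show False by simp
  qed
  then obtain i where i: "coeff p i / lead_coeff p \<notin> range rat_const" by blast
  define w where "w = coeff p i / lead_coeff p"
  have wF: "w \<in> F" unfolding w_def by (intro subfield_divide F pF)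
  have w: "w \<notin> range rat_const" using i by (simp add: w_def)
  define a b where "a = rat_num w" and "b = rat_den w"
  have ab: "w = to_fract a / to_fract b" "b \<noteq> 0"
    unfolding a_def b_def by (rule rat_num_div_den) simp

  \<comment> \<open>Since \<open>P\<close> has content \<open>1\<close>, divisibility by it descends
    from the fraction field to polynomials, by Gauss's lemma.\<close>
  define P where "P = primitive_part_fract p"
  define k where "k = fract_content p"
  have k: "k \<noteq> 0" "p = smult k (fract_poly P)"
    using p0 content_times_primitive_part_fract[of p] by (auto simp: k_def P_def)
  have P: "content P = 1" using p0 by (simp add: P_def)
  have "P \<noteq> 0" using k p0 by auto
  then obtain m where m: "\<And>i. degree (coeff P i) \<le> m" "inner_coeff m P \<noteq> 0"
    using obtain_inner_degree by blast
  \<comment> \<open>The scalar \<open>k\<close> cancels, so \<open>w\<close> is also a quotient of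
    coefficients of \<open>P\<close>, and its degree is at most the z-degree of
    \<open>P\<close>.\<close>
  have "w = to_fract (coeff P i) / to_fract (lead_coeff P)"
    using k unfolding w_def by (simp add: coeff_map_poly degree_map_poly)
  then have "rat_degree w \<le> max (degree (coeff P i)) (degree (lead_coeff P))"
    using \<open>P \<noteq> 0\<close> by (simp add: rat_degree_fraction_le)
  also have "\<dots> \<le> m" using m by simp
  finally have wm: "degree a \<le> m" "degree b \<le> m" by (auto simp: rat_degree_def a_def b_def)

  \<comment> \<open>\<open>lift q\<close> is q(T), with coefficients constant in z.\<close>
  define lift :: "complex poly \<Rightarrow> complex poly poly" where "lift = map_poly (\<lambda>c. [:c:])"
  have coeff_lift: "coeff (lift q) j = [:coeff q j:]" for q j
    by (simp add: lift_def coeff_map_poly)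
  have fract_lift: "fract_poly (lift q) = map_poly rat_const q" for q
    by (rule poly_eqI) (simp add: coeff_map_poly coeff_lift rat_const_def)
  have poly_lift: "poly (lift q) [:t:] = [:poly q t:]" for q t
    by (induction q) (auto simp: lift_def map_poly_pCons)
  \<comment> \<open>\<open>L\<close> is b(z) a(T) - a(z) b(T), that is, \<open>graph_poly w\<close>
    with its denominator cleared.\<close>
  define L where "L = smult b (lift a) - smult a (lift b)"
  have bw: "to_fract b * w = to_fract a" using ab by simp
  have L: "fract_poly L = smult (to_fract b) (graph_poly w)"
    by (simp add: L_def graph_poly_def fract_lift smult_diff_right bw flip: a_def b_def)
  have "L \<noteq> 0" using L graph_poly_nonzero[OF w] ab by auto
  have degL: "degree (coeff L j) \<le> m" for j
    unfolding L_def using wm by (auto simp: coeff_lift intro!: degree_diff_le)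
  have "p dvd graph_poly w" using p_dvd graph_poly_over[OF F wF] by simp
  then have "fract_poly P dvd fract_poly L" using k L ab by (simp add: smult_dvd_iff dvd_smult)
  then have "P dvd L" using P by (rule fract_poly_dvdD)
  then obtain Q where Q: "L = P * Q" by (rule dvdE)
  have "Q \<noteq> 0" using \<open>L \<noteq> 0\<close> Q by auto
  then obtain e where e: "\<And>i. degree (coeff Q i) \<le> e" "inner_coeff e Q \<noteq> 0"
    using obtain_inner_degree by blast
  \<comment> \<open>The nonzero product of the leading z-coefficients of \<open>P\<close> and
    \<open>Q\<close> forces z-degree at least \<open>m + e\<close> on \<open>L\<close>, whose
    z-degree is at most \<open>m\<close>.\<close>
  have "inner_coeff (m + e) L \<noteq> 0" using m e Q by (simp add: inner_coeff_mult)
  then obtain j where "coeff (coeff L j) (m + e) \<noteq> 0"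
    by (metis coeff_0 coeff_inner_coeff poly_eqI)
  then have "m + e \<le> degree (coeff L j)" by (rule le_degree)
  then have "e = 0" using degL[of j] by linarith
  define Q0 where "Q0 = inner_coeff 0 Q"
  have QQ0: "Q = lift Q0"
    using e \<open>e = 0\<close> by (intro poly_eqI)
      (auto simp: coeff_lift Q0_def coeff_pCons coeff_eq_0 split: nat.split)
  \<comment> \<open>At a root t of \<open>Q0\<close> the factorization gives b(z) a(t) = a(z) b(t),
    so t is a common root of a and b or \<open>w\<close> is constant.\<close>
  have "degree Q0 = 0"
  proof (rule ccontr)
    assume "degree Q0 \<noteq> 0"
    then have "\<not> constant (poly Q0)" by (simp add: constant_degree)
    then obtain t where "poly Q0 t = 0" using fundamental_theorem_of_algebra by blast
    then have "poly L [:t:] = 0" by (simp add: Q QQ0 poly_lift)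
    then have "smult (poly a t) b = smult (poly b t) a" by (simp add: L_def poly_lift)
    then have "to_fract ([:poly a t:] * b) = to_fract ([:poly b t:] * a)" by simp
    then have "rat_const (poly a t) * to_fract b = rat_const (poly b t) * to_fract a"
      unfolding to_fract_mult rat_const_def .
    then have "rat_const (poly a t) * to_fract b = rat_const (poly b t) * w * to_fract b"
      by (simp add: mult_ac flip: bw)
    then have *: "rat_const (poly a t) = rat_const (poly b t) * w" using ab(2) by simp
    show False
    proof (cases "poly b t = 0")
      case True
      with * have "poly a t = 0" by simp
      with True rat_num_den_no_common_root show False by (simp add: a_def b_def)
    next
      case False
      with * have "w = rat_const (poly a t / poly b t)" by (simp add: field_simps)
      with w show False by blast
    qed
  qed
  then obtain q where q: "Q0 = [:q:]" by (metis degree_eq_zeroE)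
  have LP: "L = smult [:q:] P" unfolding Q QQ0 q by (simp add: lift_def map_poly_pCons)
  then have *: "smult (rat_const q) (fract_poly P) = smult (to_fract b) (graph_poly w)"
    using L by (simp add: rat_const_def)
  have "q \<noteq> 0" using LP \<open>L \<noteq> 0\<close> by auto
  \<comment> \<open>Now \<open>p\<close> and \<open>graph_poly w\<close> differ by a scalar, so a
    multiple of the minimal polynomial already has coefficients in C(w).\<close>
  then have "p = smult (k / rat_const q) (smult (rat_const q) (fract_poly P))"
    using k by simp
  then have "p = smult (k / rat_const q * to_fract b) (graph_poly w)"
    unfolding * by simp
  then have w_dvd: "graph_poly w dvd p" by (metis dvd_refl dvd_smult)
  have "F \<subseteq> rat_adjoin {w}"
  proof
    fix g assume "g \<in> F"
    then have "p dvd graph_poly g" using graph_poly_over[OF F] by (intro p_dvd) auto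
    with w_dvd have "graph_poly w dvd graph_poly g" by (rule dvd_trans)
    moreover have const: "range rat_const \<subseteq> rat_adjoin {w}" by auto
    moreover have "coeff (graph_poly w) i \<in> rat_adjoin {w}" for i
      using const by (intro graph_poly_over is_subfield_rat_adjoin in_rat_adjoin) simp_all
    ultimately show "g \<in> rat_adjoin {w}"
      using in_subfield_if_graph_poly_dvd[OF is_subfield_rat_adjoin _ _ poly_graph_poly_var]
      by blast
  qed
  with that wF w show thesis by blast
qed

section \<open>Power series expansions at zero\<close>

text \<open>The orders agree, so the quotient t of the unit parts is a power series with t^m = 1.
  Differentiating gives t' = 0, hence t is constant.\<close>

lemma fps_power_eq_imp_proportional:
  fixes x y :: "complex fps"
  assumes "x ^ m = y ^ m" "m > 0" "y \<noteq> 0"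
  obtains c where "c \<noteq> 0" "x = fps_const c * y"
proof -
  have "x \<noteq> 0"
  proof
    assume "x = 0"
    then have "y ^ m = 0" using assms(1,2) by (simp add: zero_power)
    with assms(3) show False by simp
  qed
  have "m * subdegree x = m * subdegree y" using arg_cong[OF assms(1), of subdegree] by simp
  then have deg: "subdegree x = subdegree y" using assms(2) by simp
  define d where "d = subdegree x"
  define u v where "u = unit_factor x" and "v = unit_factor y"
  have x: "x = u * fps_X ^ d" and y: "y = v * fps_X ^ d"
    unfolding u_def v_def d_def using fps_unit_factor_decompose[of x] fps_unit_factor_decompose[of y] deg
    by auto
  have u0: "u $ 0 \<noteq> 0" and v0: "v $ 0 \<noteq> 0"
    unfolding u_def v_def using \<open>x \<noteq> 0\<close> assms(3) by auto
  have "u ^ m = v ^ m" using assms(1) unfolding x y by (simp add: power_mult_distrib)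
  define t where "t = u * inverse v"
  have u: "u = t * v" using v0 by (simp add: t_def mult.assoc inverse_mult_eq_1)
  have "v \<noteq> 0" "t \<noteq> 0" using v0 u0 u by auto
  have "t ^ m = 1" using \<open>u ^ m = v ^ m\<close> \<open>v \<noteq> 0\<close> by (simp add: u power_mult_distrib)
  then have "fps_deriv (t ^ m) = 0" by simp
  then have "fps_deriv t = 0" using assms(2) \<open>t \<noteq> 0\<close> by (simp add: fps_deriv_power')
  then have t: "t = fps_const (t $ 0)" by simp
  have "x = fps_const (t $ 0) * y" unfolding x y u by (subst t) (simp add: mult.assoc)
  moreover have "t $ 0 \<noteq> 0" using t \<open>t \<noteq> 0\<close> by auto
  ultimately show thesis using that by blast
qed

text \<open>The constant term has an m-th root in the complex numbers, from which the formal radical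
  builds the whole series.\<close>

lemma fps_complex_root:
  fixes u :: "complex fps"
  assumes "u $ 0 \<noteq> 0" "m > 0"
  obtains v where "v ^ m = u"
proof -
  obtain c where c: "c ^ m = u $ 0"
  proof -
    have "card {z. z ^ m = u $ 0} \<noteq> 0" using assms card_nth_roots[of "u $ 0" m] by simp
    then have "{z. z ^ m = u $ 0} \<noteq> {}" by force
    with that show thesis by blast
  qed
  obtain k where k: "m = Suc k" using assms(2) by (cases m) auto
  have "fps_radical (\<lambda>_ _. c) (Suc k) u ^ Suc k = u"
    using power_radical[OF assms(1), of "\<lambda>_ _. c" k] c k by simp
  with that k show thesis by blast
qed

text \<open>Write \<open>\<beta>\<close> as X^m times a unit and absorb an m-th root of the unit
  into X.\<close>

lemma fps_local_power_coordinate: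
  fixes \<beta> :: "complex fps"
  assumes "\<beta> \<noteq> 0" "\<beta> $ 0 = 0"
  obtains \<kappa> m where "\<kappa> $ 0 = 0" "\<kappa> $ 1 \<noteq> 0" "m > 0" "\<beta> = \<kappa> ^ m"
proof -
  define m where "m = subdegree \<beta>"
  have m: "m > 0" using assms unfolding m_def by (simp add: subdegree_eq_0_iff flip: neq0_conv)
  define u where "u = unit_factor \<beta>"
  have "u $ 0 \<noteq> 0" using assms(1) by (simp add: u_def)
  then obtain v where v: "v ^ m = u" using m by (rule fps_complex_root)
  have "v $ 0 \<noteq> 0" using \<open>u $ 0 \<noteq> 0\<close> m unfolding v[symmetric] by (auto simp: fps_power_zeroth)
  moreover have "\<beta> = (v * fps_X) ^ m"
    using fps_unit_factor_decompose[of \<beta>]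
    unfolding power_mult_distrib v u_def[symmetric] m_def[symmetric] .
  ultimately show thesis using that[of "v * fps_X" m] m by simp
qed

text \<open>In the local coordinate \<open>\<kappa>\<close> the map \<open>\<beta>\<close> is a power, so its local deck transformations are
  the rotations of \<open>\<kappa>\<close>.\<close>

lemma fps_compose_eq_imp_series:
  fixes \<beta> y t :: "complex fps"
  assumes "\<beta> \<noteq> 0" "\<beta> $ 0 = 0" and y: "y $ 0 = 0" "y \<noteq> 0" and t: "t $ 0 = 0"
    and eq: "\<beta> oo t = \<beta> oo y"
  obtains \<psi> where "t = \<psi> oo y"
proof -
  obtain \<kappa> m where \<kappa>: "\<kappa> $ 0 = 0" "\<kappa> $ 1 \<noteq> 0" and m: "m > 0" and \<beta>: "\<beta> = \<kappa> ^ m"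
    using fps_local_power_coordinate assms(1,2) by blast
  have "\<kappa> \<noteq> 0" using \<kappa> by auto
  have "(\<kappa> oo t) ^ m = (\<kappa> oo y) ^ m"
    using eq by (simp add: \<beta> fps_compose_power y t)
  moreover have "\<kappa> oo y \<noteq> 0" using \<open>\<kappa> \<noteq> 0\<close> y by (simp add: fps_compose_eq_0_iff)
  ultimately obtain c where c: "\<kappa> oo t = fps_const c * (\<kappa> oo y)"
    using fps_power_eq_imp_proportional m by blast
  \<comment> \<open>As \<open>\<kappa>\<close> has a compositional inverse, t can be recovered from
    its value in this coordinate; the witness is the inverse of \<open>\<kappa>\<close> applied to c
    times \<open>\<kappa>\<close>.\<close>
  have "t = fps_X oo t" using t by simp
  also have "\<dots> = fps_inv \<kappa> oo (\<kappa> oo t)"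
    using fps_compose_assoc[OF t \<kappa>(1), of "fps_inv \<kappa>"] fps_inv[OF \<kappa>] by simp
  also have "\<kappa> oo t = (fps_const c * \<kappa>) oo y" unfolding c using y by (simp add: fps_compose_mult_distrib)
  also have "fps_inv \<kappa> oo ((fps_const c * \<kappa>) oo y) = fps_inv \<kappa> oo (fps_const c * \<kappa>) oo y"
    using \<kappa>(1) y by (intro fps_compose_assoc) auto
  finally show thesis by (rule that)
qed

section \<open>Laurent expansions of rational functions at zero\<close>

abbreviation poly_fls :: "complex poly \<Rightarrow> complex fls" where
  "poly_fls p \<equiv> fps_to_fls (fps_of_poly p)"

text \<open>Laurent series accommodate poles at \<open>0\<close>, which makes the expansion a
  homomorphism of fields.\<close>

definition rat_fls :: "ratfun \<Rightarrow> complex fls" where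
  "rat_fls f = poly_fls (rat_num f) / poly_fls (rat_den f)"

lemma poly_fls_eq_iff: "poly_fls p = poly_fls q \<longleftrightarrow> p = q"
  by (simp add: fps_of_poly_eq_iff)

lemma poly_fls_eq_0_iff: "poly_fls p = 0 \<longleftrightarrow> p = 0"
  using poly_fls_eq_iff[of p 0] by simp

lemma poly_fls_mult: "poly_fls (p * q) = poly_fls p * poly_fls q"
  by (simp add: fps_of_poly_mult fls_times_fps_to_fls)

lemma rat_fls_fraction:
  assumes "q \<noteq> 0"
  shows "rat_fls (to_fract p / to_fract q) = poly_fls p / poly_fls q"
proof -
  define f where "f = to_fract p / to_fract q"
  have "p * rat_den f = rat_num f * q" unfolding f_def by (rule rat_num_den_cross[OF assms])
  then have "poly_fls p * poly_fls (rat_den f) = poly_fls (rat_num f) * poly_fls q"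
    by (metis poly_fls_mult)
  then show ?thesis unfolding f_def[symmetric] rat_fls_def
    using assms by (simp add: frac_eq_eq poly_fls_eq_0_iff del: fps_to_fls_eq_0_iff)
qed

lemma rat_fls_to_fract: "rat_fls (to_fract p) = poly_fls p"
  using rat_fls_fraction[of 1 p] by simp

lemma rat_fls_const [simp]: "rat_fls (rat_const c) = fls_const c"
  by (simp add: rat_const_def rat_fls_to_fract fps_of_poly_const)

lemma rat_fls_0 [simp]: "rat_fls 0 = 0"
  using rat_fls_const[of 0] by simp

lemma rat_fls_1 [simp]: "rat_fls 1 = 1"
  using rat_fls_const[of 1] by simp

lemma rat_fls_var [simp]: "rat_fls rat_var = fls_X"
  by (simp add: rat_var_def rat_fls_to_fract)

lemma rat_fls_mult [simp]: "rat_fls (f * g) = rat_fls f * rat_fls g"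
proof -
  obtain p q where f: "q \<noteq> 0" "f = to_fract p / to_fract q" by (rule ratfun_cases)
  obtain r s where g: "s \<noteq> 0" "g = to_fract r / to_fract s" by (rule ratfun_cases)
  have "f * g = to_fract (p * r) / to_fract (q * s)" using f g by simp
  then show ?thesis unfolding f(2) g(2) using f g
    by (simp add: rat_fls_fraction poly_fls_mult del: to_fract_mult)
qed

lemma rat_fls_diff [simp]: "rat_fls (f - g) = rat_fls f - rat_fls g"
proof -
  obtain p q where f: "q \<noteq> 0" "f = to_fract p / to_fract q" by (rule ratfun_cases)
  obtain r s where g: "s \<noteq> 0" "g = to_fract r / to_fract s" by (rule ratfun_cases)
  have "f - g = to_fract (p * s - r * q) / to_fract (q * s)"
    using f g by (simp add: diff_frac_eq)
  moreover have "fps_of_poly q \<noteq> 0" "fps_of_poly s \<noteq> 0"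
    using f g poly_fls_eq_0_iff by auto
  ultimately show ?thesis unfolding f(2) g(2) using f g
    by (simp add: rat_fls_fraction poly_fls_mult fps_of_poly_diff diff_frac_eq
        del: to_fract_mult to_fract_diff)
qed

lemma rat_fls_add [simp]: "rat_fls (f + g) = rat_fls f + rat_fls g"
  using rat_fls_diff[of f "- g"] rat_fls_diff[of 0 g] by simp

lemma rat_fls_inverse [simp]: "rat_fls (inverse f) = inverse (rat_fls f)"
proof (cases "f = 0")
  case False
  then have "rat_fls f * rat_fls (inverse f) = 1" by (simp flip: rat_fls_mult)
  then show ?thesis by (metis inverse_unique)
qed simp

lemma rat_fls_eval:
  assumes "rat_fls h = fps_to_fls y" "y $ 0 = 0"
  shows "rat_fls (rat_eval p h) = fps_to_fls (fps_of_poly p oo y)"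
proof (induction p)
  case (pCons a p)
  then show ?case using assms
    by (simp add: fps_of_poly_pCons fps_compose_add_distrib fps_compose_mult_distrib
        fls_times_fps_to_fls mult.commute)
qed simp

lemma rat_fls_regular:
  assumes "poly q 0 \<noteq> 0"
  shows "rat_fls (to_fract p / to_fract q) = fps_to_fls (fps_of_poly p * inverse (fps_of_poly q))"
proof -
  have "fps_of_poly q * inverse (fps_of_poly q) = 1"
    using assms by (intro inverse_mult_eq_1') (simp add: poly_0_coeff_0)
  then have "poly_fls q * fps_to_fls (inverse (fps_of_poly q)) = 1"
    by (metis fls_times_fps_to_fls fps_one_to_fls)
  then have "fps_to_fls (inverse (fps_of_poly q)) = inverse (poly_fls q)" by (metis inverse_unique)
  moreover have "q \<noteq> 0" using assms by auto
  ultimately show ?thesis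
    by (simp only: rat_fls_fraction[OF \<open>q \<noteq> 0\<close>] fls_times_fps_to_fls divide_inverse[of "poly_fls p"])
qed

text \<open>The functions whose expansion is p(y)/q(y), i.e. a Laurent series in \<open>y\<close>.
  Clearing the denominator leaves only compositions of power series.\<close>

definition series_subfield :: "complex fps \<Rightarrow> ratfun set" where
  "series_subfield y =
     {g. \<exists>p q. q \<noteq> 0 \<and> rat_fls g * fps_to_fls (q oo y) = fps_to_fls (p oo y)}"

lemma in_series_subfieldI:
  assumes "rat_fls g = fps_to_fls (p oo y)"
  shows "g \<in> series_subfield y"
  unfolding series_subfield_def using assms by (intro CollectI exI[of _ p] exI[of _ 1]) simp

lemma rat_const_in_series_subfield: "rat_const c \<in> series_subfield y"
  by (rule in_series_subfieldI[of _ "fps_const c"]) simp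

text \<open>Composition with \<open>y\<close> is multiplicative since \<open>y\<close> has no
  constant term, and injective since \<open>y\<close> is nonzero; hence denominators multiply and
  fractions invert.\<close>

lemma is_subfield_series_subfield:
  assumes y: "y $ 0 = 0" "y \<noteq> 0"
  shows "is_subfield (series_subfield y)"
  unfolding is_subfield_def
proof (intro conjI ballI)
  show "0 \<in> series_subfield y" "1 \<in> series_subfield y"
    using rat_const_in_series_subfield[of 0] rat_const_in_series_subfield[of 1] by auto
  have *: "fps_to_fls ((p * q) oo y) = fps_to_fls (p oo y) * fps_to_fls (q oo y)" for p q
    using y by (simp add: fps_compose_mult_distrib fls_times_fps_to_fls)
  fix f g assume "f \<in> series_subfield y" "g \<in> series_subfield y"
  then obtain p q r s where f: "q \<noteq> 0" "rat_fls f * fps_to_fls (q oo y) = fps_to_fls (p oo y)"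
    and g: "s \<noteq> 0" "rat_fls g * fps_to_fls (s oo y) = fps_to_fls (r oo y)"
    unfolding series_subfield_def by blast
  have "rat_fls (f - g) * fps_to_fls ((q * s) oo y) = fps_to_fls ((p * s - r * q) oo y)"
    by (simp add: fps_compose_sub_distrib * flip: f(2) g(2)) (simp add: algebra_simps)
  then show "f - g \<in> series_subfield y" unfolding series_subfield_def using f(1) g(1)
    by (intro CollectI exI[of _ "p * s - r * q"] exI[of _ "q * s"]) simp
  have "rat_fls (f * g) * fps_to_fls ((q * s) oo y) = fps_to_fls ((p * r) oo y)"
    by (simp add: * mult_ac flip: f(2) g(2))
  then show "f * g \<in> series_subfield y" unfolding series_subfield_def using f(1) g(1)
    by (intro CollectI exI[of _ "p * r"] exI[of _ "q * s"]) simp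
next
  fix f assume "f \<in> series_subfield y"
  then obtain p q where f: "q \<noteq> 0" "rat_fls f * fps_to_fls (q oo y) = fps_to_fls (p oo y)"
    unfolding series_subfield_def by blast
  show "inverse f \<in> series_subfield y"
  proof (cases "rat_fls f = 0")
    case True
    then show ?thesis using f by (intro in_series_subfieldI[of _ 0]) simp
  next
    case False
    have "q oo y \<noteq> 0" using f y by (simp add: fps_compose_eq_0_iff)
    then have "p \<noteq> 0" using f False by auto
    moreover have "rat_fls (inverse f) * fps_to_fls (p oo y) = fps_to_fls (q oo y)"
      using False by (simp flip: f(2))
    ultimately show ?thesis unfolding series_subfield_def by blast
  qed
qed

text \<open>Comparing orders in z q(y) = p(y) shows that the order of \<open>y\<close> divides
  \<open>1\<close>. This is where a multiple zero is used.\<close>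

lemma rat_var_notin_series_subfield:
  assumes y: "y $ 0 = 0" "subdegree y \<ge> 2"
  shows "rat_var \<notin> series_subfield y"
proof
  assume "rat_var \<in> series_subfield y"
  then obtain p q where q: "q \<noteq> 0" "fls_X * fps_to_fls (q oo y) = fps_to_fls (p oo y)"
    unfolding series_subfield_def by auto
  then have eq: "fps_X * (q oo y) = p oo y"
    by (metis fls_times_fps_to_fls fps_X_to_fls fps_to_fls_eq_iff)
  have "y \<noteq> 0" using y by auto
  then have "q oo y \<noteq> 0" using q y by (simp add: fps_compose_eq_0_iff)
  then have "Suc (subdegree q * subdegree y) = subdegree p * subdegree y"
    using arg_cong[OF eq, of subdegree] y by simp
  then have "subdegree y dvd Suc (subdegree q * subdegree y)" by (metis dvd_triv_right)
  then have "subdegree y dvd 1" by (metis Suc_eq_plus1 dvd_add_right_iff dvd_triv_right)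
  with y show False by simp
qed

text \<open>If \<open>B \<circ> T = B \<circ> Y\<close>, we may replace \<open>B\<close> by \<open>1/B\<close> or \<open>B - B 0\<close>, so that \<open>B\<close> vanishes at \<open>0\<close>.\<close>

lemma in_series_subfield_of_compose_eq:
  assumes Y: "rat_fls Y = fps_to_fls y" "y $ 0 = 0" "y \<noteq> 0"
    and T: "rat_fls T = fps_to_fls t" "t $ 0 = 0"
    and nc: "Y \<notin> range rat_const" "T \<notin> range rat_const" "B \<notin> range rat_const"
    and eq: "rat_compose B T = rat_compose B Y"
  shows "T \<in> series_subfield y"
proof -
  define p q where "p = rat_num B" and "q = rat_den B"
  have q: "q \<noteq> 0" by (simp add: q_def)
  have "p \<noteq> 0" using nc(3) unfolding p_def by (metis rangeI rat_const_0 rat_num_eq_0_iff)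
  have pq: "rat_eval p T * rat_eval q Y = rat_eval p Y * rat_eval q T"
    using eq nc q unfolding rat_compose_eq p_def[symmetric] q_def[symmetric]
    by (simp add: frac_eq_eq)
  \<comment> \<open>Here c/d stands for 1/B if B has a pole at \<open>0\<close>, and for B - B(0)
    otherwise.\<close>
  have "\<exists>c d. c \<noteq> 0 \<and> poly c 0 = 0 \<and> poly d 0 \<noteq> 0 \<and>
    rat_eval c T * rat_eval d Y = rat_eval c Y * rat_eval d T"
  proof (cases "poly q 0 = 0")
    case True
    then have "poly p 0 \<noteq> 0"
      using rat_num_den_no_common_root[of B 0] by (auto simp: p_def q_def)
    then show ?thesis using q True pq by (intro exI[of _ q] exI[of _ p]) (simp add: mult.commute)
  next
    case False
    define k where "k = poly p 0 / poly q 0"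
    have "p - smult k q \<noteq> 0"
    proof
      assume "p - smult k q = 0"
      then have "p = smult k q" by simp
      then have "to_fract p = rat_const k * to_fract q"
        by (metis rat_eval_smult rat_eval_var)
      then have "B = rat_const k" using rat_num_div_den[of B] q
        unfolding p_def[symmetric] q_def[symmetric] by simp
      with nc(3) show False by blast
    qed
    then show ?thesis using False pq
      by (intro exI[of _ "p - smult k q"] exI[of _ q]) (auto simp: k_def algebra_simps)
  qed
  then obtain c d where cd: "c \<noteq> 0" "poly c 0 = 0" "poly d 0 \<noteq> 0"
    and *: "rat_eval c T * rat_eval d Y = rat_eval c Y * rat_eval d T" by blast
  define C D where "C = fps_of_poly c" and "D = fps_of_poly d"
  have "fps_to_fls ((C oo t) * (D oo y)) = fps_to_fls ((C oo y) * (D oo t))"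
    using arg_cong[OF *, of rat_fls]
    by (simp add: rat_fls_eval[OF Y(1,2)] rat_fls_eval[OF T] fls_times_fps_to_fls C_def D_def)
  then have CD: "(C oo t) * (D oo y) = (C oo y) * (D oo t)" by simp
  have D0: "D $ 0 \<noteq> 0" and C0: "C $ 0 = 0" using cd by (simp_all add: D_def C_def poly_0_coeff_0)
  have "C \<noteq> 0" using cd fps_of_poly_eq_iff[of c 0] by (simp add: C_def)
  \<comment> \<open>The expansion of c/d at \<open>0\<close>, a power series because d does not
    vanish there.\<close>
  define \<beta> where "\<beta> = C * inverse D"
  have comp: "\<beta> oo v = (C oo v) * inverse (D oo v)" if "v $ 0 = 0" for v
    using that D0 by (simp add: \<beta>_def fps_compose_mult_distrib fps_inverse_compose)
  have inv: "(D oo v) * inverse (D oo v) = 1" for v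
    using D0 by (intro inverse_mult_eq_1') simp
  have "\<beta> oo t = (C oo t) * (D oo y) * inverse (D oo y) * inverse (D oo t)"
    using comp[OF T(2)] inv[of y] by (simp add: mult_ac)
  also have "\<dots> = (C oo y) * inverse (D oo y)"
    unfolding CD using inv[of t] by (simp add: mult_ac)
  also have "\<dots> = \<beta> oo y" using comp[OF Y(2)] by simp
  finally have "\<beta> oo t = \<beta> oo y" .
  moreover have "\<beta> \<noteq> 0" using \<open>C \<noteq> 0\<close> D0 by (auto simp: \<beta>_def)
  moreover have "\<beta> $ 0 = 0" using C0 by (simp add: \<beta>_def)
  ultimately obtain \<psi> where "t = \<psi> oo y"
    using fps_compose_eq_imp_series Y T by blast
  then show ?thesis using T by (intro in_series_subfieldI) simp
qed

text \<open>Solve Y = (a + b w)/(c + d w) for w. The coefficient Y d - b of w is nonzero, as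
  otherwise Y would be constant.\<close>

lemma compose_degree_1_invert:
  assumes "rat_degree \<alpha> \<le> 1" "Y = rat_compose \<alpha> w" "Y \<notin> range rat_const" "w \<notin> range rat_const"
  shows "w \<in> rat_adjoin {Y}"
proof -
  obtain a b c d where \<alpha>: "rat_num \<alpha> = [:a, b:]" "rat_den \<alpha> = [:c, d:]"
    using assms(1) by (rule rat_degree_le_1E)
  have "[:c, d:] \<noteq> 0" using rat_den_nonzero[of \<alpha>] by (simp add: \<alpha>)
  then have "rat_eval [:c, d:] w \<noteq> 0" using assms(4) by (intro rat_eval_nonzero)
  then have "Y * rat_eval [:c, d:] w = rat_eval [:a, b:] w"
    using assms(2) by (simp add: rat_compose_eq \<alpha> del: rat_eval_pCons)
  then have eq: "w * (Y * rat_const d - rat_const b) = rat_const a - Y * rat_const c"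
    by (simp add: algebra_simps)
  have nz: "Y * rat_const d - rat_const b \<noteq> 0"
  proof
    assume 0: "Y * rat_const d - rat_const b = 0"
    have "\<exists>k. Y = rat_const k"
    proof (cases "d = 0")
      case True
      with 0 eq have "Y * rat_const c = rat_const a" by simp
      moreover have "c \<noteq> 0" using True \<open>[:c, d:] \<noteq> 0\<close> by simp
      ultimately have "Y = rat_const (a / c)" by (simp add: field_simps)
      then show ?thesis ..
    next
      case False
      with 0 have "Y = rat_const (b / d)" by (simp add: field_simps)
      then show ?thesis ..
    qed
    with assms(3) show False by blast
  qed
  have "w = (rat_const a - Y * rat_const c) / (Y * rat_const d - rat_const b)"
    using nz eq by (simp add: nonzero_eq_divide_eq)
  also have "\<dots> \<in> rat_adjoin {Y}"
    by (intro subfield_divide subfield_diff subfield_mult is_subfield_rat_adjoin in_rat_adjoin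
        rat_const_in_adjoin) simp_all
  finally show ?thesis .
qed

lemma rat_indecomposable_left_degree:
  assumes "rat_indecomposable Y" "Y = rat_compose \<alpha> w" "rat_degree w \<ge> 2"
  shows "rat_degree \<alpha> \<le> 1"
  using assms unfolding rat_indecomposable_def by (metis One_nat_def Suc_1 not_less_eq_eq)

lemma rat_eval_monom: "rat_eval (monom c k) h = rat_const c * h ^ k"
  by (induction k) (auto simp: monom_0 monom_Suc)

lemma rat_eval_sum: "rat_eval (\<Sum>i\<in>A. f i) h = (\<Sum>i\<in>A. rat_eval (f i) h)"
  by (induction A rule: infinite_finite_induct) auto

lemma rat_var_power_nonconstant:
  assumes "n > 0"
  shows "rat_var ^ n \<notin> range rat_const"
proof -
  have "rat_var ^ n = to_fract (monom 1 n)"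
    using rat_eval_monom[of 1 n rat_var] by simp
  then show ?thesis using assms
    by (auto simp: rat_const_def) (metis degree_monom_eq degree_pCons_0 less_numeral_extra(3) one_neq_zero)
qed

lemma subfield_containing_var:
  assumes "is_subfield K" "range rat_const \<subseteq> K" "rat_var \<in> K"
  shows "K = UNIV"
  using rat_compose_in_subfield[OF assms] by (metis UNIV_eq_I rat_compose_var_right)

section \<open>Rotations\<close>

definition rat_rotate :: "complex \<Rightarrow> ratfun \<Rightarrow> ratfun" where
  "rat_rotate c g = rat_compose g (rat_const c * rat_var)"

lemma rotation_nonconstant:
  assumes "c \<noteq> 0"
  shows "rat_const c * rat_var \<notin> range rat_const"
proof
  assume "rat_const c * rat_var \<in> range rat_const"
  then obtain k where "rat_const c * rat_var = rat_const k" by blast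
  then have "rat_var = rat_const (k / c)" using assms by (simp add: field_simps)
  then show False using rat_var_nonconstant by blast
qed

context
  fixes c :: complex
  assumes c: "c \<noteq> 0"
begin

lemmas rotate_nc = rotation_nonconstant[OF c]

lemma rat_rotate_simps [simp]:
  "rat_rotate c (rat_const a) = rat_const a"
  "rat_rotate c rat_var = rat_const c * rat_var"
  "rat_rotate c 0 = 0"
  "rat_rotate c 1 = 1"
  "rat_rotate c (f + g) = rat_rotate c f + rat_rotate c g"
  "rat_rotate c (f - g) = rat_rotate c f - rat_rotate c g"
  "rat_rotate c (f * g) = rat_rotate c f * rat_rotate c g"
  "rat_rotate c (inverse f) = inverse (rat_rotate c f)"
  "rat_rotate c (f / g) = rat_rotate c f / rat_rotate c g"
  "rat_rotate c (f ^ k) = rat_rotate c f ^ k"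
  "rat_rotate c f = 0 \<longleftrightarrow> f = 0"
  "rat_rotate c f \<in> range rat_const \<longleftrightarrow> f \<in> range rat_const"
  using rotate_nc by (simp_all add: rat_rotate_def)

lemma rat_rotate_rotate:
  "rat_rotate c (rat_rotate d f) = rat_rotate (c * d) f"
proof -
  have "rat_compose (rat_const d * rat_var) (rat_const c * rat_var) = rat_const (c * d) * rat_var"
    by (simp add: rotate_nc)
  then show ?thesis unfolding rat_rotate_def by (simp only: rat_compose_assoc[OF rotate_nc])
qed

lemma rat_rotate_compose:
  "rat_rotate c (rat_compose f g) = rat_compose f (rat_rotate c g)"
  unfolding rat_rotate_def by (rule rat_compose_assoc[OF rotate_nc])

lemma rat_rotate_to_fract:
  "rat_rotate c (to_fract p) = to_fract (pcompose p (monom c (Suc 0)))"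
proof -
  have "to_fract (monom c (Suc 0)) = rat_const c * rat_var"
    using rat_eval_monom[of c "Suc 0" rat_var] by simp
  then show ?thesis using rat_eval_pcompose[of p "monom c (Suc 0)" rat_var]
    by (simp add: rat_rotate_def rotate_nc)
qed

lemma pcompose_rotation_eq_0_iff: "pcompose p (monom c (Suc 0)) = 0 \<longleftrightarrow> p = 0"
  using c by (simp add: poly_eq_iff)

lemma rat_degree_rotate_le: "rat_degree (rat_rotate c g) \<le> rat_degree g"
proof -
  have deg: "degree (pcompose p (monom c (Suc 0))) \<le> degree p" for p
    by (intro degree_le) (auto simp: coeff_eq_0)
  have "rat_rotate c g = to_fract (pcompose (rat_num g) (monom c (Suc 0))) /
      to_fract (pcompose (rat_den g) (monom c (Suc 0)))"
    by (subst rat_num_div_den[of g]) (simp add: rat_rotate_to_fract)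
  also have "rat_degree \<dots> \<le> max (degree (pcompose (rat_num g) (monom c (Suc 0))))
      (degree (pcompose (rat_den g) (monom c (Suc 0))))"
    by (intro rat_degree_fraction_le) (simp add: pcompose_rotation_eq_0_iff)
  also have "\<dots> \<le> rat_degree g"
    unfolding rat_degree_def using deg[of "rat_num g"] deg[of "rat_den g"] by linarith
  finally show ?thesis .
qed

text \<open>By minimality of \<open>rat_adjoin\<close>, a rotation that fixes generators fixes the
  field they generate.\<close>

lemma is_subfield_rotate_fixed: "is_subfield {g. rat_rotate c g = g}"
  by (simp add: is_subfield_def)

end

lemma rat_rotate_1 [simp]: "rat_rotate 1 f = f"
  by (simp add: rat_rotate_def)

text \<open>A reduced fraction with a zero at \<open>0\<close> has no pole there, and the rotation
  fixes \<open>0\<close>; so both expansions are power series without constant term.\<close>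

lemma zero_expansion:
  assumes "rat_zero_order 0 Y \<ge> 1" "Y \<noteq> 0" "c \<noteq> 0"
  obtains y t where "rat_fls Y = fps_to_fls y" "y $ 0 = 0" "y \<noteq> 0" "subdegree y = rat_zero_order 0 Y"
    "rat_fls (rat_rotate c Y) = fps_to_fls t" "t $ 0 = 0"
proof -
  define p q where "p = rat_num Y" and "q = rat_den Y"
  have Y: "Y = to_fract p / to_fract q" unfolding p_def q_def by (rule rat_num_div_den)
  have "p \<noteq> 0" using assms(2) by (simp add: p_def)
  then have p0: "poly p 0 = 0" using assms(1) by (simp add: rat_zero_order_def order_root flip: p_def)
  then have q0: "poly q 0 \<noteq> 0"
    unfolding p_def q_def by (rule rat_num_den_no_common_root)
  define y where "y = fps_of_poly p * inverse (fps_of_poly q)"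
  define p' q' where "p' = pcompose p (monom c (Suc 0))" and "q' = pcompose q (monom c (Suc 0))"
  define t where "t = fps_of_poly p' * inverse (fps_of_poly q')"
  have pq': "poly p' 0 = 0" "poly q' 0 \<noteq> 0"
    using p0 q0 by (simp_all add: p'_def q'_def poly_pcompose poly_monom)
  have P: "fps_of_poly p \<noteq> 0" using \<open>p \<noteq> 0\<close> fps_of_poly_eq_iff[of p 0] by simp
  have Q: "fps_of_poly q $ 0 \<noteq> 0" using q0 by (simp add: poly_0_coeff_0)
  show thesis
  proof (rule that)
    show "rat_fls Y = fps_to_fls y" unfolding Y y_def by (rule rat_fls_regular[OF q0])
    show "y $ 0 = 0" "t $ 0 = 0" using p0 pq' by (simp_all add: y_def t_def poly_0_coeff_0)
    show "y \<noteq> 0" using P Q by (auto simp: y_def)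
    have "subdegree y = subdegree (fps_of_poly p)"
      using P Q by (auto simp: y_def subdegree_mult)
    then show "subdegree y = rat_zero_order 0 Y"
      using \<open>p \<noteq> 0\<close> by (simp add: subdegree_fps_of_poly rat_zero_order_def p_def)
    have "rat_rotate c Y = to_fract p' / to_fract q'"
      using assms(3) by (simp add: Y p'_def q'_def rat_rotate_to_fract)
    then show "rat_fls (rat_rotate c Y) = fps_to_fls t"
      using rat_fls_regular[OF pq'(2), of p'] by (simp add: t_def)
  qed
qed

section \<open>Rotations of an indecomposable function and their eigenfunctions\<close>

lemma nonconstant_if_degree_ge_2:
  assumes "rat_degree Y \<ge> 2"
  shows "Y \<notin> range rat_const"
  using assms rat_degree_eq_0_iff[of Y] by auto

text \<open>The field \<open>F\<close> of series in Y equals C(w) by Lueroth, with Y a function of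
  w. Since z is not in \<open>F\<close>, w has degree at least two, so indecomposability gives F =
  C(Y); and \<open>F\<close> contains the rotated Y.\<close>

lemma rotate_in_adjoin:
  assumes ind: "rat_indecomposable Y" and deg: "rat_degree Y \<ge> 2"
    and ord: "rat_zero_order 0 Y \<ge> 2" and "c \<noteq> 0"
    and B: "B \<notin> range rat_const" "rat_compose B (rat_rotate c Y) = rat_compose B Y"
  shows "rat_rotate c Y \<in> rat_adjoin {Y}"
proof -
  have Y: "Y \<notin> range rat_const" using deg by (rule nonconstant_if_degree_ge_2)
  then have "Y \<noteq> 0" by (rule nonconstant_nonzero)
  obtain y t where y: "rat_fls Y = fps_to_fls y" "y $ 0 = 0" "y \<noteq> 0" "subdegree y = rat_zero_order 0 Y"
    and t: "rat_fls (rat_rotate c Y) = fps_to_fls t" "t $ 0 = 0"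
    using zero_expansion[of Y c] \<open>Y \<noteq> 0\<close> assms by auto
  define F where "F = series_subfield y"
  have F: "is_subfield F" "range rat_const \<subseteq> F" unfolding F_def
    using is_subfield_series_subfield[OF y(2,3)] rat_const_in_series_subfield by auto
  have "Y \<in> F" unfolding F_def using y by (intro in_series_subfieldI[of _ fps_X]) simp
  then obtain w where w: "w \<in> F" "w \<notin> range rat_const" "F \<subseteq> rat_adjoin {w}"
    using lueroth[OF F _ Y] by blast
  have wF: "rat_adjoin {w} \<subseteq> F" using F w by (intro rat_adjoin_minimal) auto
  have "\<not> rat_degree w \<le> 1"
  proof
    assume "rat_degree w \<le> 1"
    \<comment> \<open>Here w is regarded as the degree one function w applied to z, and
      inverted.\<close>
    then have "rat_var \<in> rat_adjoin {w}"
      using w by (intro compose_degree_1_invert[of w]) simp_all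
    with wF have "rat_var \<in> F" by blast
    then show False using rat_var_notin_series_subfield[of y] y ord by (simp add: F_def)
  qed
  moreover obtain \<alpha> where \<alpha>: "Y = rat_compose \<alpha> w"
    using w \<open>Y \<in> F\<close> rat_adjoin_singleton[OF w(2)] by blast
  ultimately have "rat_degree \<alpha> \<le> 1"
    using rat_indecomposable_left_degree[OF ind \<alpha>] by simp
  then have "w \<in> rat_adjoin {Y}" using \<alpha> Y w(2) by (rule compose_degree_1_invert)
  then have "rat_adjoin {w} \<subseteq> rat_adjoin {Y}"
    by (intro rat_adjoin_minimal is_subfield_rat_adjoin) auto
  moreover have "rat_rotate c Y \<in> F" unfolding F_def
    using in_series_subfield_of_compose_eq[OF y(1-3) t Y _ B] Y \<open>c \<noteq> 0\<close> by simp
  ultimately show ?thesis using w(3) by blast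
qed

text \<open>A degree one \<open>\<mu>\<close> with \<open>Y(cz) = \<mu> (Y z)\<close> fixes \<open>0\<close>, the value of \<open>Y\<close> at \<open>0\<close>, so it is affine in
  the coordinate \<open>1/Y\<close>.\<close>

lemma rotate_inverse_affine:
  assumes ind: "rat_indecomposable Y" and deg: "rat_degree Y \<ge> 2"
    and ord: "rat_zero_order 0 Y \<ge> 1" and c: "c \<noteq> 0"
    and "rat_rotate c Y \<in> rat_adjoin {Y}"
  obtains \<gamma> \<delta> where "rat_rotate c (inverse Y) = rat_const \<gamma> * inverse Y + rat_const \<delta>"
proof -
  have Y: "Y \<notin> range rat_const" using deg by (rule nonconstant_if_degree_ge_2)
  then have "Y \<noteq> 0" by (rule nonconstant_nonzero)
  obtain \<mu> where \<mu>: "rat_rotate c Y = rat_compose \<mu> Y"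
    using assms(5) rat_adjoin_singleton[OF Y] by blast
  \<comment> \<open>Undoing the rotation inside turns the relation into a decomposition of Y itself,
    Y = \<open>\<mu>\<close>(V), to which indecomposability applies.\<close>
  define V where "V = rat_rotate (inverse c) Y"
  have VY: "rat_rotate c V = Y" using c by (simp add: V_def rat_rotate_rotate)
  have "Y = rat_rotate (inverse c) (rat_compose \<mu> Y)"
    unfolding \<mu>[symmetric] using c by (simp add: rat_rotate_rotate)
  then have "Y = rat_compose \<mu> V" using c by (simp add: rat_rotate_compose V_def)
  moreover have "rat_degree V \<ge> 2" using rat_degree_rotate_le[OF c, of V] deg VY by simp
  ultimately have "rat_degree \<mu> \<le> 1" by (intro rat_indecomposable_left_degree[OF ind])
  then obtain a b d e where num: "rat_num \<mu> = [:a, b:]" and den: "rat_den \<mu> = [:d, e:]"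
    by (rule rat_degree_le_1E)
  have "[:d, e:] \<noteq> 0" using rat_den_nonzero[of \<mu>] by (simp add: den)
  then have nz: "rat_eval [:d, e:] Y \<noteq> 0" using Y by (intro rat_eval_nonzero)
  then have "rat_rotate c Y * rat_eval [:d, e:] Y = rat_eval [:a, b:] Y"
    using \<mu> by (simp add: rat_compose_eq num den del: rat_eval_pCons)
  then have eq: "rat_rotate c Y * (rat_const d + rat_const e * Y) = rat_const a + rat_const b * Y"
    by (simp add: mult_ac)
  obtain y t where y: "rat_fls Y = fps_to_fls y" "y $ 0 = 0"
    and t: "rat_fls (rat_rotate c Y) = fps_to_fls t" "t $ 0 = 0"
    using zero_expansion[OF ord \<open>Y \<noteq> 0\<close> c] by metis
  \<comment> \<open>Compare constant terms: both Y and its rotation vanish at \<open>0\<close>,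
    which leaves a = 0.\<close>
  have "fps_to_fls (t * (fps_const d + fps_const e * y)) = fps_to_fls (fps_const a + fps_const b * y)"
    using arg_cong[OF eq, of rat_fls] by (simp add: y t fls_times_fps_to_fls)
  then have "(t * (fps_const d + fps_const e * y)) $ 0 = (fps_const a + fps_const b * y) $ 0"
    by (simp only: fps_to_fls_eq_iff)
  then have "a = 0" using y t by simp
  with eq have eq': "rat_rotate c Y * (rat_const d + rat_const e * Y) = rat_const b * Y" by simp
  have "rat_const d + rat_const e * Y \<noteq> 0" using nz by (simp add: mult.commute)
  with eq' \<open>Y \<noteq> 0\<close> c have "b \<noteq> 0" by auto
  have "rat_rotate c (inverse Y) = rat_const (d / b) * inverse Y + rat_const (e / b)"
    using eq' \<open>b \<noteq> 0\<close> \<open>Y \<noteq> 0\<close> c by (simp add: field_simps)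
  then show thesis by (rule that)
qed

text \<open>For \<open>\<gamma>\<close> = 1, n rotations add n \<open>\<delta>\<close> to X but are
  the identity, so \<open>\<delta>\<close> = 0. Otherwise subtract the fixed point of the affine
  map.\<close>

lemma rotate_affine_eigenvector:
  assumes "\<epsilon> ^ n = 1" "n > 0" and X: "rat_rotate \<epsilon> X = rat_const \<gamma> * X + rat_const \<delta>"
  obtains k where "rat_rotate \<epsilon> (X - rat_const k) = rat_const \<gamma> * (X - rat_const k)"
proof (cases "\<gamma> = 1")
  case True
  have \<epsilon>: "\<epsilon> \<noteq> 0" using assms by (metis power_0_left zero_neq_one neq0_conv)
  have iter: "rat_rotate (\<epsilon> ^ j) X = X + rat_const (of_nat j * \<delta>)" for j
  proof (induction j)
    case (Suc j)
    have "rat_rotate (\<epsilon> ^ Suc j) X = rat_rotate \<epsilon> (rat_rotate (\<epsilon> ^ j) X)"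
      using \<epsilon> by (simp add: rat_rotate_rotate)
    also have "\<dots> = rat_rotate \<epsilon> X + rat_const (of_nat j * \<delta>)"
      unfolding Suc by (simp only: rat_rotate_simps[OF \<epsilon>])
    also have "\<dots> = X + rat_const (of_nat (Suc j) * \<delta>)"
      by (simp add: X True distrib_right)
    finally show ?case .
  qed simp
  from iter[of n] assms have "\<delta> = 0" by simp
  then show thesis using that[of 0] X by simp
next
  case False
  have \<epsilon>: "\<epsilon> \<noteq> 0" using assms by (metis power_0_left zero_neq_one neq0_conv)
  define k where "k = \<delta> / (1 - \<gamma>)"
  have "\<delta> - k = - \<gamma> * k" using False by (simp add: k_def field_simps)
  then have "rat_const \<delta> - rat_const k = - rat_const \<gamma> * rat_const k"
    by (metis rat_const_diff rat_const_minus rat_const_mult)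
  then have "rat_rotate \<epsilon> (X - rat_const k) = rat_const \<gamma> * (X - rat_const k)"
    using \<epsilon> by (simp add: X algebra_simps)
  then show thesis by (rule that)
qed

text \<open>Comparing coefficients, every exponent i that occurs satisfies
  \<open>\<epsilon>\<close>^i = c. As \<open>\<epsilon>\<close> has order n, all these exponents are
  congruent modulo n to the least one.\<close>

lemma rotation_eigenpoly:
  assumes "n > 0" and "\<And>k. \<epsilon> ^ k = 1 \<Longrightarrow> n dvd k" and "\<epsilon> \<noteq> 0"
    and "p \<noteq> 0" and p: "pcompose p (monom \<epsilon> (Suc 0)) = smult c p"
  obtains j q where "to_fract p = rat_var ^ j * rat_eval q (rat_var ^ n)"
proof -
  define j where "j = (LEAST i. coeff p i \<noteq> 0)"
  have "coeff p (degree p) \<noteq> 0" using \<open>p \<noteq> 0\<close> by simp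
  then have j: "coeff p j \<noteq> 0" unfolding j_def by (rule LeastI)
  have i: "\<epsilon> ^ i = c" if "coeff p i \<noteq> 0" for i
    using arg_cong[OF p, of "\<lambda>p. coeff p i"] that by simp
  have supp: "i = j + n * ((i - j) div n)" if "coeff p i \<noteq> 0" for i
  proof -
    have "j \<le> i" unfolding j_def by (rule Least_le) (rule that)
    then have "\<epsilon> ^ j * \<epsilon> ^ (i - j) = \<epsilon> ^ i" by (simp flip: power_add)
    also have "\<dots> = \<epsilon> ^ j" using i[OF that] i[OF j] by simp
    finally have "n dvd i - j" using assms(2)[of "i - j"] \<open>\<epsilon> \<noteq> 0\<close> by simp
    with \<open>j \<le> i\<close> show ?thesis by simp
  qed
  \<comment> \<open>Where i < j or the division by n is inexact, the coefficient of \<open>p\<close>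
    is zero.\<close>
  define q where "q = (\<Sum>i\<le>degree p. monom (coeff p i) ((i - j) div n))"
  have "to_fract p = rat_eval (\<Sum>i\<le>degree p. monom (coeff p i) i) rat_var"
    by (simp only: rat_eval_var poly_as_sum_of_monoms)
  also have "\<dots> = (\<Sum>i\<le>degree p. rat_const (coeff p i) * rat_var ^ i)"
    by (simp only: rat_eval_sum rat_eval_monom)
  also have "\<dots> = (\<Sum>i\<le>degree p. rat_var ^ j * (rat_const (coeff p i) * (rat_var ^ n) ^ ((i - j) div n)))"
  proof (intro sum.cong refl)
    fix i
    have "rat_var ^ i = rat_var ^ j * (rat_var ^ n) ^ ((i - j) div n)" if "coeff p i \<noteq> 0"
      by (subst supp[OF that]) (simp add: power_add power_mult)
    then show "rat_const (coeff p i) * rat_var ^ i =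
        rat_var ^ j * (rat_const (coeff p i) * (rat_var ^ n) ^ ((i - j) div n))"
      by (cases "coeff p i = 0") auto
  qed
  also have "\<dots> = rat_var ^ j * rat_eval q (rat_var ^ n)"
    by (simp only: q_def rat_eval_sum rat_eval_monom sum_distrib_left)
  finally show thesis by (rule that)
qed

text \<open>In lowest terms, the numerator and the denominator of an eigenfunction must be
  eigenpolynomials themselves; \<open>rotation_eigenpoly\<close> then applies to each.\<close>

lemma rotation_eigenfunction:
  assumes "n > 0" and prim: "\<And>k. \<epsilon> ^ k = 1 \<Longrightarrow> n dvd k" and "\<epsilon> \<noteq> 0"
    and "W \<noteq> 0" and W: "rat_rotate \<epsilon> W = rat_const \<gamma> * W"
  obtains s R where "W = rat_var ^ s * rat_compose R (rat_var ^ n)"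
proof -
  define p q where "p = rat_num W" and "q = rat_den W"
  define p' q' where "p' = pcompose p (monom \<epsilon> (Suc 0))" and "q' = pcompose q (monom \<epsilon> (Suc 0))"
  have Wpq: "W = to_fract p / to_fract q" unfolding p_def q_def by (rule rat_num_div_den)
  have "p \<noteq> 0" "q \<noteq> 0" using \<open>W \<noteq> 0\<close> by (simp_all add: p_def q_def)
  have q'0: "q' \<noteq> 0" using \<open>q \<noteq> 0\<close> \<open>\<epsilon> \<noteq> 0\<close> by (simp add: q'_def pcompose_rotation_eq_0_iff)
  have "\<gamma> \<noteq> 0" using W \<open>W \<noteq> 0\<close> \<open>\<epsilon> \<noteq> 0\<close> by auto
  have "to_fract p' / to_fract q' = rat_const \<gamma> * (to_fract p / to_fract q)"
    using W \<open>\<epsilon> \<noteq> 0\<close> by (simp add: Wpq rat_rotate_to_fract p'_def q'_def)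
  then have "to_fract (p' * q) = to_fract (smult \<gamma> p * q')"
    using \<open>q \<noteq> 0\<close> q'0 by (simp add: field_simps flip: rat_eval_var)
  then have eq: "p' * q = smult \<gamma> p * q'" by (simp only: to_fract_eq_iff)
  have "q dvd p * q'"
    using eq \<open>\<gamma> \<noteq> 0\<close> by (metis dvd_smult_cancel dvd_triv_right mult_smult_left)
  then have "q dvd q'" using coprime_rat_num_den[of W]
    by (simp add: coprime_dvd_mult_right_iff coprime_commute p_def q_def)
  then obtain r where r: "q' = q * r" by (rule dvdE)
  have "degree q' \<le> degree q" unfolding q'_def
    by (intro degree_le) (auto simp: coeff_eq_0)
  then have "degree r = 0" using r q'0 \<open>q \<noteq> 0\<close> by (auto simp: degree_mult_eq)
  then obtain c where "r = [:c:]" by (metis degree_eq_zeroE)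
  with r have q': "q' = smult c q" by simp
  with eq have "p' * q = smult (\<gamma> * c) p * q" by (simp add: mult.commute)
  then have p': "p' = smult (\<gamma> * c) p" using \<open>q \<noteq> 0\<close> by (metis mult_right_cancel)
  obtain i P where P: "to_fract p = rat_var ^ i * rat_eval P (rat_var ^ n)"
    using rotation_eigenpoly[OF \<open>n > 0\<close> prim \<open>\<epsilon> \<noteq> 0\<close> \<open>p \<noteq> 0\<close>] p' unfolding p'_def by blast
  obtain j Q where Q: "to_fract q = rat_var ^ j * rat_eval Q (rat_var ^ n)"
    using rotation_eigenpoly[OF \<open>n > 0\<close> prim \<open>\<epsilon> \<noteq> 0\<close> \<open>q \<noteq> 0\<close>] q' unfolding q'_def by blast
  have nc: "rat_var ^ n \<notin> range rat_const" using \<open>n > 0\<close> by (rule rat_var_power_nonconstant)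
  \<comment> \<open>The extra factor keeps the exponent of z nonnegative: z^(-j) is z^((n - 1) j)
    divided by (z^n)^j.\<close>
  define R where "R = to_fract P / (to_fract Q * rat_var ^ j)"
  have "rat_compose R (rat_var ^ n) = rat_eval P (rat_var ^ n) / (rat_eval Q (rat_var ^ n) * rat_var ^ (n * j))"
    using nc by (simp add: R_def power_mult)
  moreover have "rat_var ^ (n * j) = rat_var ^ ((n - 1) * j) * rat_var ^ j"
    using \<open>n > 0\<close> by (cases n) (simp_all add: power_add)
  ultimately have "W = rat_var ^ (i + (n - 1) * j) * rat_compose R (rat_var ^ n)"
    by (simp add: Wpq P Q power_add field_simps)
  then show thesis by (rule that)
qed

lemma exists_primitive_root_of_unity:
  assumes "n > 0"
  obtains \<epsilon> :: complex where "\<epsilon> ^ n = 1" "\<And>k. \<epsilon> ^ k = 1 \<Longrightarrow> n dvd k"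
proof
  define \<epsilon> where "\<epsilon> = cis (2 * pi / n)"
  have pow: "\<epsilon> ^ k = cis (2 * pi * k / n)" for k by (simp add: \<epsilon>_def DeMoivre mult_ac)
  show n: "cis (2 * pi / n) ^ n = 1" using assms pow[of n] by (simp add: \<epsilon>_def)
  show "n dvd k" if "cis (2 * pi / n) ^ k = 1" for k
  proof -
    have "\<epsilon> ^ k = \<epsilon> ^ (n * (k div n) + k mod n)" by simp
    also have "\<dots> = \<epsilon> ^ (k mod n)" using n unfolding power_add power_mult by (simp add: \<epsilon>_def)
    finally have "cis (2 * pi * (k mod n) / n) = cis (2 * pi * 0 / n)"
      using that by (simp add: pow flip: \<epsilon>_def)
    moreover have "inj_on (\<lambda>k. cis (2 * pi * real k / real n)) {..<n}"
      using bij_betw_roots_unity[OF assms] by (rule bij_betw_imp_inj_on)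
    ultimately have "k mod n = 0" using assms by (auto dest!: inj_onD[of _ _ "k mod n" 0])
    then show ?thesis by auto
  qed
qed

theorem theorem1p2:
  fixes Y :: ratfun and n :: nat
  assumes "rat_indecomposable Y"
    and "rat_degree Y \<ge> 2"
    and "rat_zero_order 0 Y \<ge> 2"
    and "n \<ge> 2"
  shows "(rat_adjoin {rat_var ^ n, Y} = UNIV \<and>
          rat_adjoin {rat_var ^ n} \<inter> rat_adjoin {Y} \<noteq> range rat_const)
         \<longleftrightarrow>
         (\<exists>\<sigma> R (s::nat). moebius \<sigma> \<and> gcd s n = 1 \<and>
            Y = rat_compose \<sigma> (rat_var ^ s * rat_compose R (rat_var ^ n)))"
    (is "?L \<longleftrightarrow> ?R")
proof
  have "n > 0" using assms(4) by simp
  have Y: "Y \<notin> range rat_const" using assms(2) by (rule nonconstant_if_degree_ge_2)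
  have zn: "rat_var ^ n \<notin> range rat_const" using \<open>n > 0\<close> by (rule rat_var_power_nonconstant)
  {
    assume ?L
    then have gen: "rat_adjoin {rat_var ^ n, Y} = UNIV" by blast
    obtain f where f: "f \<in> rat_adjoin {rat_var ^ n}" "f \<in> rat_adjoin {Y}" "f \<notin> range rat_const"
      using \<open>?L\<close> by auto
    obtain A where A: "f = rat_compose A (rat_var ^ n)" using f rat_adjoin_singleton[OF zn] by blast
    obtain B where B: "f = rat_compose B Y" using f rat_adjoin_singleton[OF Y] by blast
    have "B \<notin> range rat_const" using f(3) Y unfolding B by simp
    obtain \<epsilon> :: complex where \<epsilon>: "\<epsilon> ^ n = 1" "\<And>k. \<epsilon> ^ k = 1 \<Longrightarrow> n dvd k"
      using exists_primitive_root_of_unity[OF \<open>n > 0\<close>] by blast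
    have \<epsilon>0: "\<epsilon> \<noteq> 0" using \<epsilon>(1) \<open>n > 0\<close> by (metis power_0_left zero_neq_one neq0_conv)
    have rot_zn: "rat_rotate \<zeta> (rat_compose g (rat_var ^ n)) = rat_compose g (rat_var ^ n)"
      if "\<zeta> ^ n = 1" for g \<zeta>
    proof -
      have "\<zeta> \<noteq> 0" using that \<open>n > 0\<close> by (metis power_0_left zero_neq_one neq0_conv)
      then show ?thesis
        using that by (simp add: rat_rotate_compose power_mult_distrib flip: rat_const_power)
    qed
    \<comment> \<open>Both sides are f: as a function of z^n it is unchanged by the
      rotation.\<close>
    have "rat_compose B (rat_rotate \<epsilon> Y) = rat_compose B Y"
      unfolding rat_rotate_compose[OF \<epsilon>0, symmetric] B[symmetric] unfolding A
      by (rule rot_zn[OF \<epsilon>(1)])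
    then have "rat_rotate \<epsilon> Y \<in> rat_adjoin {Y}"
      using assms \<epsilon>0 \<open>B \<notin> _\<close> by (intro rotate_in_adjoin)
    then obtain \<gamma> \<delta> where "rat_rotate \<epsilon> (inverse Y) = rat_const \<gamma> * inverse Y + rat_const \<delta>"
      using rotate_inverse_affine[of Y \<epsilon>] assms \<epsilon>0 by (metis One_nat_def Suc_1 Suc_leD)
    then obtain k where k: "rat_rotate \<epsilon> (inverse Y - rat_const k) = rat_const \<gamma> * (inverse Y - rat_const k)"
      using rotate_affine_eigenvector \<epsilon>(1) \<open>n > 0\<close> by blast
    define W where "W = inverse Y - rat_const k"
    have YW: "Y = inverse (W + rat_const k)" by (simp add: W_def)
    have Wnc: "W \<notin> range rat_const"
    proof
      assume "W \<in> range rat_const"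
      then obtain l where "W = rat_const l" by blast
      then have "Y = rat_const (inverse (l + k))" using YW by simp
      with Y show False by blast
    qed
    then have "W \<noteq> 0" by (rule nonconstant_nonzero)
    then obtain s R where W: "W = rat_var ^ s * rat_compose R (rat_var ^ n)"
      using rotation_eigenfunction[OF \<open>n > 0\<close> \<epsilon>(2) \<epsilon>0 _ k[folded W_def]] by blast
    \<comment> \<open>The map 1/(z + k), which inverts W = 1/Y - k.\<close>
    define \<sigma> where "\<sigma> = (rat_const 0 * rat_var + rat_const 1) / (rat_const 1 * rat_var + rat_const k)"
    have "moebius \<sigma>" unfolding moebius_def \<sigma>_def
      by (intro exI[of _ 0] exI[of _ 1] exI[of _ k]) simp
    moreover have "Y = rat_compose \<sigma> W" using Wnc by (simp add: \<sigma>_def YW inverse_eq_divide)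
    moreover have "gcd s n = 1"
    proof -
      define d where "d = gcd s n"
      \<comment> \<open>A root of unity with \<open>\<zeta>\<close>^n = \<open>\<zeta>\<close>^s =
        1. Its rotation fixes z^n and W, hence Y and all of C(z), so \<open>\<zeta>\<close> = 1,
        which forces d = 1.\<close>
      define \<zeta> where "\<zeta> = \<epsilon> ^ (n div d)"
      have "\<zeta> ^ n = 1" using \<epsilon>(1) by (simp add: \<zeta>_def power_mult[symmetric] mult.commute[of _ n])
        (simp add: power_mult)
      have "(n div d) * s = n * (s div d)"
        by (simp add: d_def div_mult_swap dvd_div_mult)
      then have "\<zeta> ^ s = 1" using \<epsilon>(1) by (simp add: \<zeta>_def flip: power_mult) (simp add: power_mult)
      have \<zeta>0: "\<zeta> \<noteq> 0" using \<epsilon>0 by (simp add: \<zeta>_def)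
      have "rat_rotate \<zeta> W = W" unfolding W
        using \<zeta>0 \<open>\<zeta> ^ s = 1\<close> rot_zn[OF \<open>\<zeta> ^ n = 1\<close>]
        by (simp add: power_mult_distrib flip: rat_const_power)
      then have "rat_rotate \<zeta> Y = Y" using \<zeta>0 by (simp add: YW)
      moreover have "rat_rotate \<zeta> (rat_var ^ n) = rat_var ^ n"
        using \<zeta>0 \<open>\<zeta> ^ n = 1\<close> by (simp add: power_mult_distrib flip: rat_const_power)
      ultimately have "rat_adjoin {rat_var ^ n, Y} \<subseteq> {g. rat_rotate \<zeta> g = g}"
        using \<zeta>0 by (intro rat_adjoin_minimal is_subfield_rotate_fixed) auto
      then have "rat_rotate \<zeta> rat_var = rat_var" using gen by blast
      then have "rat_const \<zeta> = rat_const 1" using \<zeta>0 by simp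
      then have "\<zeta> = 1" by (simp only: rat_const_eq_iff)
      then have "n dvd n div d" using \<epsilon>(2) by (simp add: \<zeta>_def)
      moreover obtain e where e: "n = d * e" unfolding d_def by (metis dvdE gcd_dvd2)
      ultimately have "d * e dvd e" using \<open>n > 0\<close> by simp
      then have "d = 1" using \<open>n > 0\<close> unfolding e by (auto simp: dvd_mult_cancel2)
      then show "gcd s n = 1" by (simp add: d_def)
    qed
    ultimately show ?R unfolding W by (intro exI conjI)
  }
  {
    assume ?R
    then obtain \<sigma> R s where "moebius \<sigma>" and s: "gcd s n = 1"
      and YW: "Y = rat_compose \<sigma> (rat_var ^ s * rat_compose R (rat_var ^ n))" by (elim exE conjE)
    then obtain a b c d where "a * d - b * c \<noteq> 0"
      and "\<sigma> = (rat_const a * rat_var + rat_const b) / (rat_const c * rat_var + rat_const d)"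
      unfolding moebius_def by blast
    then have "\<sigma> = to_fract [:b, a:] / to_fract [:d, c:]" "[:d, c:] \<noteq> 0"
      by (auto simp: mult_ac add_ac simp flip: rat_eval_var)
    then have "rat_degree \<sigma> \<le> 1"
      using rat_degree_fraction_le[of "[:d, c:]" "[:b, a:]"] by (simp split: if_splits)
    define r where "r = rat_compose R (rat_var ^ n)"
    define W where "W = rat_var ^ s * r"
    have W: "Y = rat_compose \<sigma> W" using YW by (simp add: W_def r_def)
    have Wnc: "W \<notin> range rat_const"
    proof
      assume "W \<in> range rat_const"
      then obtain k where "W = rat_const k" by blast
      \<comment> \<open>If k is a pole of \<open>\<sigma>\<close>, both sides are \<open>0\<close>
        by the convention for division by zero.\<close>
      then have "Y = rat_const (poly (rat_num \<sigma>) k / poly (rat_den \<sigma>) k)"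
        by (simp add: W rat_compose_eq)
      with Y show False by blast
    qed
    have WY: "W \<in> rat_adjoin {Y}" using \<open>rat_degree \<sigma> \<le> 1\<close> W Y Wnc by (rule compose_degree_1_invert)
    have rz: "r \<in> rat_adjoin {rat_var ^ n}"
      unfolding r_def rat_adjoin_singleton[OF zn] by blast
    have "r \<noteq> 0" using Wnc unfolding W_def by (metis mult_zero_right rangeI rat_const_0)
    define K where "K = rat_adjoin {rat_var ^ n, Y}"
    have K: "is_subfield K" "range rat_const \<subseteq> K" "rat_var ^ n \<in> K" "Y \<in> K"
      unfolding K_def by (auto intro: is_subfield_rat_adjoin in_rat_adjoin)
    have "rat_adjoin {rat_var ^ n} \<subseteq> K" "rat_adjoin {Y} \<subseteq> K"
      using K by (simp_all add: rat_adjoin_minimal)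
    then have "W / r \<in> K" using WY rz K by (auto intro: subfield_divide)
    then have zs: "rat_var ^ s \<in> K" using \<open>r \<noteq> 0\<close> by (simp add: W_def)
    \<comment> \<open>For s = 0 the gcd would be n, which is at least two; Bezout with natural
      coefficients needs s nonzero here.\<close>
    have "s \<noteq> 0" using s assms(4) by (metis gcd_0_left_nat numeral_le_one_iff semiring_norm(69))
    then obtain x y where "s * x = n * y + 1" using bezout_nat[of s n] s by auto
    then have "(rat_var ^ s) ^ x = (rat_var ^ n) ^ y * rat_var"
      by (simp flip: power_mult)
    then have "rat_var = (rat_var ^ s) ^ x / (rat_var ^ n) ^ y" by simp
    also have "\<dots> \<in> K" using K zs by (simp add: subfield_divide subfield_power)
    finally have "K = UNIV" using K by (intro subfield_containing_var)
    moreover have "rat_adjoin {rat_var ^ n} \<inter> rat_adjoin {Y} \<noteq> range rat_const"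
    proof -
      \<comment> \<open>A nonconstant element of the intersection: W^n equals (z^n)^s r^n and is
        also a power of an element of C(Y).\<close>
      have "W ^ n \<in> rat_adjoin {Y}" using WY by (intro subfield_power is_subfield_rat_adjoin)
      moreover have "W ^ n = (rat_var ^ n) ^ s * r ^ n"
        by (simp add: W_def power_mult_distrib mult.commute flip: power_mult)
      then have "W ^ n \<in> rat_adjoin {rat_var ^ n}"
        using rz by (simp add: subfield_mult subfield_power is_subfield_rat_adjoin in_rat_adjoin)
      moreover have "W ^ n \<notin> range rat_const"
        using rat_compose_nonconstant[OF Wnc, of "rat_var ^ n"] zn Wnc by simp
      ultimately show ?thesis by blast
    qed
    ultimately show ?L unfolding K_def by blast
  }
qed

end
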